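(* Let $\mathcal{G}$ be an ensemble of $n$-node hard random geometric graphs in $[0,1]^d$ (with Euclidean distance) with connection range $r_0$ and nodes distributed according to a probability measure of the form $\nu(\vec x)=\prod_{i=1}^d\pi(x_i)$, where $\pi$ is a probability measure on $[0,1]$. Let $H_t(\mathcal{G})$ be the limit of the entropy $H(\mathcal{G})$ as $d\to\infty$, where $t=\lim_{d\to\infty}\left(\frac{r_0^2}{\sqrt d}-\mu_c\sqrt d\right)$ (if it exists) is the normalised connection range. Then $$H_t(\mathcal{G})<H\left(G\left(n,\tfrac12\right)\right)=\binom n2,$$ provided that the coordinate-wise probability measure $\pi$ has kurtosis greater than $1$.
   Context: A hard random geometric graph with connection range (radius) $r_0$ on a metric space $(\Omega,\rho)$ is built by placing $n$ points $X_1,\dots,X_n$ independently at random in $\Omega$ according to a probability measure $\nu$, taking vertex set $\{1,\dots,n\}$, and including the edge $(i,j)$ if and only if $\rho(X_i,X_j)\le r_0$. The ensemble is the set of all such graphs with the resulting probability distribution on labelled graphs. In the limit $d\to\infty$, $n$ is kept fixed and $r_0$ is a function of $d$ but not of $n$. The entropy of an ensemble $\mathcal{G}$ with probability measure $\mathbb{P}$ is $H(\mathcal{G})=-\sum_{g\in\mathcal{G}}\mathbb{P}(g)\log\mathbb{P}(g)$, with logarithm to base 2. $\mu_c$ is the average squared distance $\mathbb{E}[|X-Y|^2]$ between two independent points $X,Y$ of $[0,1]$ with law $\pi$. The kurtosis of $\pi$ is the fourth central moment of $X\sim\pi$ divided by the square of its variance. $G(n,p)$ is the Erdős–Rényi ensemble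 on $n$ labelled nodes: each edge is present independently with probability $p$.
   Formalization: The formal theorem assumes n ≥ 3: the strict inequality fails for n = 0, 1 (both sides are 0) and for n = 2 with t = 0 (a single edge of limiting probability 1/2 has entropy 1); the case n = 2, t ≠ 0 is also left out. *)

theory Defs
  imports "HOL-Probability.Probability"
begin

text \<open>
  Labelled simple graphs on \<open>{1..n}\<close> are identified with their edge sets, so an ensemble of
  \<open>n\<close>-node graphs is a probability measure on the finite discrete space \<open>Pow (vertex_pairs n)\<close>.
\<close>

definition vertex_pairs :: "nat \<Rightarrow> nat set set" where
  "vertex_pairs n = {e. e \<subseteq> {1..n} \<and> card e = 2}"

definition geometric_graph :: "('a \<Rightarrow> 'a \<Rightarrow> real) \<Rightarrow> nat \<Rightarrow> real \<Rightarrow> (nat \<Rightarrow> 'a) \<Rightarrow> nat set set" where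
  "geometric_graph \<rho> n r X =
     {{i, j} | i j. i \<in> {1..n} \<and> j \<in> {1..n} \<and> i \<noteq> j \<and> \<rho> (X i) (X j) \<le> r}"

definition hard_rgg ::
    "'a measure \<Rightarrow> ('a \<Rightarrow> 'a \<Rightarrow> real) \<Rightarrow> nat \<Rightarrow> real \<Rightarrow> nat set set measure" where
  "hard_rgg \<nu> \<rho> n r =
     distr (\<Pi>\<^sub>M i\<in>{1..n}. \<nu>) (count_space (Pow (vertex_pairs n))) (geometric_graph \<rho> n r)"

definition erdos_renyi :: "nat \<Rightarrow> real \<Rightarrow> nat set set measure" where
  "erdos_renyi n p =
     distr (\<Pi>\<^sub>M e\<in>vertex_pairs n. measure_pmf (bernoulli_pmf p))
       (count_space (Pow (vertex_pairs n))) (\<lambda>b. {e \<in> vertex_pairs n. b e})"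

text \<open>Terms with probability \<open>0\<close> contribute \<open>0\<close>, which is the usual convention.\<close>

definition ensemble_entropy :: "nat set set measure \<Rightarrow> real" where
  "ensemble_entropy G = - (\<Sum>g\<in>space G. measure G {g} * log 2 (measure G {g}))"

text \<open>Points of \<open>\<real>\<^sup>d\<close> are functions on the index set \<open>{..<d}\<close>, since \<open>d\<close> tends to infinity.\<close>

definition coordinate_product :: "nat \<Rightarrow> real measure \<Rightarrow> (nat \<Rightarrow> real) measure" where
  "coordinate_product d \<pi> = (\<Pi>\<^sub>M k\<in>{..<d}. \<pi>)"

definition euclidean_dist :: "nat \<Rightarrow> (nat \<Rightarrow> real) \<Rightarrow> (nat \<Rightarrow> real) \<Rightarrow> real" where
  "euclidean_dist d x y = L2_set (\<lambda>k. x k - y k) {..<d}"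

definition cube_rgg :: "nat \<Rightarrow> real measure \<Rightarrow> nat \<Rightarrow> real \<Rightarrow> nat set set measure" where
  "cube_rgg d \<pi> n r = hard_rgg (coordinate_product d \<pi>) (euclidean_dist d) n r"

definition mean_sq_dist :: "real measure \<Rightarrow> real" where
  "mean_sq_dist \<pi> = (\<integral>(x, y). \<bar>x - y\<bar>\<^sup>2 \<partial>(\<pi> \<Otimes>\<^sub>M \<pi>))"

definition central_moment :: "real measure \<Rightarrow> nat \<Rightarrow> real" where
  "central_moment \<pi> k = (\<integral>x. (x - (\<integral>y. y \<partial>\<pi>)) ^ k \<partial>\<pi>)"

text \<open>
  For zero variance this is \<open>0\<close> by the convention \<open>x / 0 = 0\<close>; hence \<open>kurtosis \<pi> > 1\<close> entails
  that the variance is nonzero.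
\<close>

definition kurtosis :: "real measure \<Rightarrow> real" where
  "kurtosis \<pi> = central_moment \<pi> 4 / (central_moment \<pi> 2)\<^sup>2"

text \<open>
  \<open>distr\<close> is only meaningful along measurable maps; the following facts confirm that both
  ensembles are probability measures.
\<close>

lemma finite_vertex_pairs: "finite (vertex_pairs n)"
  unfolding vertex_pairs_def by simp

lemma geometric_graph_subset: "geometric_graph \<rho> n r X \<in> Pow (vertex_pairs n)"
  by (auto simp: geometric_graph_def vertex_pairs_def)

lemma measurable_geometric_graph:
  assumes "(\<lambda>(x, y). \<rho> x y) \<in> borel_measurable (\<nu> \<Otimes>\<^sub>M \<nu>)"
  shows "geometric_graph \<rho> n r
    \<in> measurable (\<Pi>\<^sub>M i\<in>{1..n}. \<nu>) (count_space (Pow (vertex_pairs n)))"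
proof (subst measurable_count_space_eq2, goal_cases)
  case 1
  then show ?case by (simp add: finite_vertex_pairs)
next
  case 2
  let ?M = "\<Pi>\<^sub>M i\<in>{1..n}. \<nu>"
  have edge: "{X \<in> space ?M. e \<in> geometric_graph \<rho> n r X} \<in> sets ?M" for e
  proof -
    have d: "(\<lambda>X. \<rho> (X i) (X j)) \<in> borel_measurable ?M"
      if "i \<in> {1..n}" "j \<in> {1..n}" for i j
    proof -
      have "(\<lambda>X. (X i, X j)) \<in> measurable ?M (\<nu> \<Otimes>\<^sub>M \<nu>)"
        using that by measurable
      from measurable_compose[OF this assms] show ?thesis by simp
    qed
    have "{X \<in> space ?M. e \<in> geometric_graph \<rho> n r X}
      = (\<Union>(i, j)\<in>{(i, j). i \<in> {1..n} \<and> j \<in> {1..n} \<and> i \<noteq> j \<and> e = {i, j}}.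
          {X \<in> space ?M. \<rho> (X i) (X j) \<le> r})"
      by (auto simp: geometric_graph_def)
    also have "\<dots> \<in> sets ?M"
    proof (rule sets.finite_UN)
      show "finite {(i, j). i \<in> {1..n} \<and> j \<in> {1..n} \<and> i \<noteq> j \<and> e = {i, j}}"
        by (rule finite_subset[of _ "{1..n} \<times> {1..n}"]) auto
    qed (use d in \<open>auto intro: borel_measurable_le\<close>)
    finally show ?thesis .
  qed
  have "geometric_graph \<rho> n r -` {g} \<inter> space ?M \<in> sets ?M"
    if "g \<in> Pow (vertex_pairs n)" for g
  proof -
    have "geometric_graph \<rho> n r -` {g} \<inter> space ?M
      = {X \<in> space ?M. \<forall>e\<in>vertex_pairs n. e \<in> geometric_graph \<rho> n r X \<longleftrightarrow> e \<in> g}"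
      using that geometric_graph_subset[of \<rho> n r] by blast
    also have "\<dots> \<in> sets ?M"
    proof (rule sets.sets_Collect_finite_All)
      fix e
      show "{X \<in> space ?M. e \<in> geometric_graph \<rho> n r X \<longleftrightarrow> e \<in> g} \<in> sets ?M"
        using edge[of e] sets.sets_Collect_neg[OF edge[of e]] by (cases "e \<in> g") simp_all
    qed (rule finite_vertex_pairs)
    finally show ?thesis .
  qed
  then show ?case using geometric_graph_subset by blast
qed

lemma prob_space_cube_rgg:
  assumes "prob_space \<pi>" and "sets \<pi> = sets (restrict_space borel {0..1})"
  shows "prob_space (cube_rgg d \<pi> n r)"
proof -
  have id: "(\<lambda>x. x) \<in> borel_measurable \<pi>"
    using assms(2) by (simp add: measurable_cong_sets[OF assms(2) refl] measurable_restrict_space1)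
  let ?N = "coordinate_product d \<pi>"
  have c: "(\<lambda>x. x k) \<in> borel_measurable ?N" if "k < d" for k
  proof -
    have "(\<lambda>x. x k) \<in> measurable ?N \<pi>"
      unfolding coordinate_product_def using that by (intro measurable_component_singleton) simp
    from measurable_compose[OF this id] show ?thesis .
  qed
  have c1: "(\<lambda>z. fst z k - snd z k) \<in> borel_measurable (?N \<Otimes>\<^sub>M ?N)" if "k < d" for k
    using measurable_compose[OF measurable_fst c[OF that]]
      measurable_compose[OF measurable_snd c[OF that]]
    by (rule borel_measurable_diff)
  have "(\<lambda>(x, y). euclidean_dist d x y) \<in> borel_measurable (?N \<Otimes>\<^sub>M ?N)"
    unfolding euclidean_dist_def L2_set_def case_prod_beta
    by (intro measurable_compose[OF _ borel_measurable_continuous_onI[OF continuous_on_real_sqrt[OF continuous_on_id]]]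
        borel_measurable_sum borel_measurable_power c1) auto
  note m = measurable_geometric_graph[OF this]
  have "prob_space ?N"
    unfolding coordinate_product_def by (rule prob_space_PiM) (rule assms(1))
  then have "prob_space (\<Pi>\<^sub>M i\<in>{1..n}. ?N)"
    by (intro prob_space_PiM)
  then show ?thesis
    unfolding cube_rgg_def hard_rgg_def by (rule prob_space.prob_space_distr) (rule m)
qed

lemma prob_space_erdos_renyi: "prob_space (erdos_renyi n p)"
proof -
  let ?M = "\<Pi>\<^sub>M e\<in>vertex_pairs n. measure_pmf (bernoulli_pmf p)"
  have "(\<lambda>b. {e \<in> vertex_pairs n. b e}) \<in> measurable ?M (count_space (Pow (vertex_pairs n)))"
  proof (subst measurable_count_space_eq2, goal_cases)
    case 1
    then show ?case by (simp add: finite_vertex_pairs)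
  next
    case 2
    have "(\<lambda>b. {e \<in> vertex_pairs n. b e}) -` {g} \<inter> space ?M \<in> sets ?M"
      if "g \<in> Pow (vertex_pairs n)" for g
    proof -
      have "(\<lambda>b. {e \<in> vertex_pairs n. b e}) -` {g} \<inter> space ?M
        = (\<Pi>\<^sub>E e\<in>vertex_pairs n. {e \<in> g})"
        using that by (auto simp: space_PiM PiE_def)
      also have "\<dots> \<in> sets ?M"
        by (rule sets_PiM_I_finite) (auto simp: finite_vertex_pairs)
      finally show ?thesis .
    qed
    then show ?case by auto
  qed
  moreover have "prob_space ?M"
    by (intro prob_space_PiM prob_space_measure_pmf)
  ultimately show ?thesis
    unfolding erdos_renyi_def by (intro prob_space.prob_space_distr)
qed

end

theory Submission
  imports Defs
begin

text \<open>
  With \<open>u\<^sub>i\<close> the centred coordinates of the points and \<open>s\<close> the variance of \<open>\<pi>\<close>, one has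
  \<open>(x\<^sub>i - x\<^sub>j)\<^sup>2 - 2 s = (u\<^sub>i\<^sup>2 - s) + (u\<^sub>j\<^sup>2 - s) - 2 u\<^sub>i u\<^sub>j\<close>. The functions \<open>u\<^sub>i\<^sup>2 - s\<close> and
  \<open>u\<^sub>i u\<^sub>j\<close> are centred and pairwise orthogonal, so by the central limit theorem the normalised squared
  distances converge jointly to \<open>\<tau> (N\<^sub>i + N\<^sub>j) - 2 s N\<^sub>i\<^sub>j\<close> for independent standard normals, where
  \<open>\<tau>\<^sup>2\<close> is the variance of \<open>u\<^sub>i\<^sup>2\<close>. Hence the law of the graph converges, and with it the entropy,
  which is below \<open>n choose 2\<close> unless the limit law is uniform. Kurtosis above \<open>1\<close> means
  \<open>\<tau> > 0\<close>: two edges at a common vertex \<open>i\<close> are both influenced by \<open>N\<^sub>i\<close>, so in the limit they are not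
  independent fair coins.
\<close>

section \<open>Entropy\<close>

text \<open>The central limit theorem and the continuity theorem for characteristic functions enter
  only in dimension one. The former is applied to arbitrary linear combinations of the scores, which
  gives all joint characteristic functions; exponentials are then traded for indicators coordinate
  by coordinate. That exchange needs limiting scores without an atom at the threshold. They have
  none, because each edge carries a Gaussian of its own with coefficient \<open>- 2 * s\<close>, and
  \<open>s > 0\<close>.

  The variance of \<open>u\<^sub>i\<^sup>2\<close> is \<open>s\<^sup>2\<close> times (kurtosis - 1),
  which is the origin of the bound 1. At kurtosis 1 the shared terms vanish, the limiting scores are
  independent, and for \<open>t = 0\<close> the limit law is uniform. Two edges with a common vertex
  also need three vertices: for \<open>n = 2\<close> and \<open>t = 0\<close> the limit is a single
  fair coin, of entropy 1.\<close>

lemma abs_mult_ln_le: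
  fixes x :: real
  assumes "x \<ge> 0"
  shows "\<bar>x * ln x\<bar> \<le> 2 * sqrt x + x\<^sup>2"
proof (cases "x = 0")
  case False
  then have x: "x > 0" using assms by simp
  have "ln x \<le> x" using ln_le_minus_one[OF x] by simp
  then have "x * ln x \<le> x\<^sup>2" using x by (simp add: power2_eq_square)
  moreover have "- (x * ln x) \<le> 2 * sqrt x"
  proof -
    have "ln (1 / sqrt x) \<le> 1 / sqrt x"
      using ln_le_minus_one[of "1 / sqrt x"] x by simp
    then have "- ln x \<le> 2 / sqrt x"
      using x by (simp add: ln_div ln_sqrt)
    then have "x * (- ln x) \<le> x * (2 / sqrt x)" using x by (intro mult_left_mono) auto
    also have "x * (2 / sqrt x) = 2 * (x / sqrt x)" by simp
    also have "x / sqrt x = sqrt x" using x by (simp add: real_div_sqrt)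
    finally show ?thesis by simp
  qed
  moreover have "sqrt x \<ge> 0" "x\<^sup>2 \<ge> 0" using x by auto
  ultimately show ?thesis by linarith
qed simp

text \<open>\<open>log\<close> is discontinuous at 0, but the product is squeezed there by
  \<open>2 * sqrt x + x\<^sup>2\<close>, which vanishes at 0.\<close>

lemma tendsto_mult_log:
  fixes f :: "'a \<Rightarrow> real"
  assumes "(f \<longlongrightarrow> p) F" and nonneg: "\<And>x. f x \<ge> 0"
  shows "((\<lambda>x. f x * log 2 (f x)) \<longlongrightarrow> p * log 2 p) F"
proof (cases "p = 0")
  case False
  then show ?thesis
    by (intro tendsto_mult tendsto_log tendsto_const assms(1)) auto
next
  case True
  have "((\<lambda>x. 2 * sqrt (f x) + (f x)\<^sup>2) \<longlongrightarrow> 2 * sqrt 0 + 0\<^sup>2) F"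
    using assms(1) True by (intro tendsto_add tendsto_mult tendsto_const tendsto_real_sqrt tendsto_power) simp_all
  then have "((\<lambda>x. 2 * sqrt (f x) + (f x)\<^sup>2) \<longlongrightarrow> 0) F" by simp
  then have "((\<lambda>x. f x * ln (f x)) \<longlongrightarrow> 0) F"
    by (rule Lim_null_comparison[rotated])
      (simp_all add: abs_mult_ln_le nonneg del: abs_mult)
  then have "((\<lambda>x. f x * ln (f x) / ln 2) \<longlongrightarrow> 0 / ln 2) F"
    by (intro tendsto_divide tendsto_const) simp_all
  then show ?thesis using True by (simp add: log_def)
qed

text \<open>Gibbs' inequality against the uniform law: \<open>ln z \<le> z - 1\<close> at
  \<open>z = 1 / (K * p x)\<close>, with equality only for \<open>p x = 1 / K\<close>. The
  corrections \<open>1 / K - p x\<close> cancel in the sum, and one deviating point makes the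
  inequality strict.\<close>

lemma entropy_less_log_card:
  fixes p :: "'a \<Rightarrow> real"
  assumes "finite S" and nonneg: "\<And>x. x \<in> S \<Longrightarrow> p x \<ge> 0" and "sum p S = 1"
    and "y \<in> S" "p y \<noteq> 1 / card S"
  shows "- (\<Sum>x\<in>S. p x * log 2 (p x)) < log 2 (card S)"
proof -
  define K where "K = real (card S)"
  have K: "K > 0" using assms by (auto simp: K_def card_gt_0_iff)
  have le: "- (p x * ln (p x)) \<le> p x * ln K + (1 / K - p x)"
    and less: "p x \<noteq> 1 / K \<Longrightarrow> - (p x * ln (p x)) < p x * ln K + (1 / K - p x)" if "x \<in> S" for x
  proof -
    have "- (p x * ln (p x)) \<le> p x * ln K + (1 / K - p x) \<and>
      (p x \<noteq> 1 / K \<longrightarrow> - (p x * ln (p x)) < p x * ln K + (1 / K - p x))"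
    proof (cases "p x = 0")
      case False
      then have px: "p x > 0" using nonneg[OF that] by simp
      define z where "z = 1 / (K * p x)"
      have z: "z > 0" using px K by (simp add: z_def)
      have lz: "ln z = - ln K - ln (p x)" using px K by (simp add: z_def ln_div ln_mult)
      have pz: "p x * (z - 1) = 1 / K - p x" using px K by (simp add: z_def field_simps)
      have "p x * ln z \<le> p x * (z - 1)"
        using ln_le_minus_one[OF z] px by simp
      moreover have "p x * ln z < p x * (z - 1)" if "p x \<noteq> 1 / K"
      proof -
        have "z \<noteq> 1" using that px K by (auto simp: z_def field_simps)
        then have "ln z < z - 1" using ln_eq_minus_one[OF z] ln_le_minus_one[OF z] by fastforce
        then show ?thesis using px by simp
      qed
      ultimately show ?thesis unfolding pz lz by (auto simp: algebra_simps)
    qed (use K in simp)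
    then show "- (p x * ln (p x)) \<le> p x * ln K + (1 / K - p x)"
     "p x \<noteq> 1 / K \<Longrightarrow> - (p x * ln (p x)) < p x * ln K + (1 / K - p x)" by auto
  qed
  have "(\<Sum>x\<in>S. - (p x * ln (p x))) < (\<Sum>x\<in>S. p x * ln K + (1 / K - p x))"
    using assms le less by (intro sum_strict_mono_ex1) (force simp: K_def)+
  also have "\<dots> = ln K"
    using K \<open>sum p S = 1\<close>
    by (simp add: sum.distrib sum_subtractf sum_distrib_right[symmetric] flip: K_def)
  finally have "- (\<Sum>x\<in>S. p x * ln (p x)) < ln K" by (simp add: sum_negf)
  then have "- (\<Sum>x\<in>S. p x * ln (p x)) / ln 2 < ln K / ln 2"
    by (intro divide_strict_right_mono) auto
  then show ?thesis by (simp add: log_def K_def sum_divide_distrib)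
qed

section \<open>Entropy of the fair Erdos-Renyi ensemble\<close>

lemma card_vertex_pairs: "card (vertex_pairs n) = n choose 2"
  unfolding vertex_pairs_def by (subst n_subsets) auto

lemma space_erdos_renyi: "space (erdos_renyi n p) = Pow (vertex_pairs n)"
  by (simp add: erdos_renyi_def)

lemma measure_erdos_renyi_half:
  assumes "g \<subseteq> vertex_pairs n"
  shows "measure (erdos_renyi n (1/2)) {g} = 1 / 2 ^ (n choose 2)"
proof -
  let ?M = "\<Pi>\<^sub>M e\<in>vertex_pairs n. measure_pmf (bernoulli_pmf (1/2))"
  interpret finite_product_prob_space "\<lambda>_. measure_pmf (bernoulli_pmf (1/2))" "vertex_pairs n"
    by standard (rule finite_vertex_pairs)
  have pre: "(\<lambda>b. {e \<in> vertex_pairs n. b e}) -` {g'} \<inter> space ?M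
        = (\<Pi>\<^sub>E e\<in>vertex_pairs n. {e \<in> g'})" if "g' \<in> Pow (vertex_pairs n)" for g'
    using that by (auto simp: space_PiM PiE_def)
  have "(\<lambda>b. {e \<in> vertex_pairs n. b e}) \<in> measurable ?M (count_space (Pow (vertex_pairs n)))"
    by (subst measurable_count_space_eq2)
      (auto simp: finite_vertex_pairs pre intro!: sets_PiM_I_finite)
  then have "measure (erdos_renyi n (1/2)) {g} = measure ?M (\<Pi>\<^sub>E e\<in>vertex_pairs n. {e \<in> g})"
    unfolding erdos_renyi_def using assms pre[of g] by (subst measure_distr) auto
  also have "\<dots> = (\<Prod>e\<in>vertex_pairs n. measure (measure_pmf (bernoulli_pmf (1/2))) {e \<in> g})"
    by (rule finite_measure_PiM_emb) auto
  also have "\<dots> = (\<Prod>e\<in>vertex_pairs n. 1/2)"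
    by (intro prod.cong) (auto simp: measure_pmf_single pmf_bernoulli_True pmf_bernoulli_False)
  finally show ?thesis by (simp add: card_vertex_pairs power_one_over)
qed

lemma entropy_erdos_renyi_half: "ensemble_entropy (erdos_renyi n (1/2)) = real (n choose 2)"
proof -
  let ?N = "n choose 2"
  have "(\<Sum>g\<in>Pow (vertex_pairs n). measure (erdos_renyi n (1/2)) {g} * log 2 (measure (erdos_renyi n (1/2)) {g}))
    = (\<Sum>g\<in>Pow (vertex_pairs n). 1 / 2 ^ ?N * log 2 (1 / 2 ^ ?N))"
    by (intro sum.cong) (auto simp: measure_erdos_renyi_half)
  also have "\<dots> = - real ?N"
    by (simp add: card_Pow finite_vertex_pairs card_vertex_pairs log_divide log_nat_power)
  finally show ?thesis by (simp add: ensemble_entropy_def space_erdos_renyi)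
qed

section \<open>Joint weak convergence from characteristic functions\<close>

text \<open>Normalising the weights to probability densities reduces this to the one-dimensional continuity
  theorem. Weights allow the coordinates of a random vector to be treated one at a time.\<close>

lemma weighted_levy_continuity:
  fixes Y W :: "nat \<Rightarrow> 'a \<Rightarrow> real" and G V :: "'b \<Rightarrow> real"
  assumes "prob_space M" "prob_space N"
    and Y [measurable]: "\<And>d. Y d \<in> borel_measurable M" and G [measurable]: "G \<in> borel_measurable N"
    and W [measurable]: "\<And>d. W d \<in> borel_measurable M" and V [measurable]: "V \<in> borel_measurable N"
    and W0: "\<And>d x. 0 \<le> W d x" and WB: "\<And>d x. W d x \<le> B"
    and V0: "\<And>x. 0 \<le> V x" and VB: "\<And>x. V x \<le> B"
    and char: "\<And>\<theta>. (\<lambda>d. \<integral>x. W d x * iexp (\<theta> * Y d x) \<partial>M) \<longlonglongrightarrow> (\<integral>x. V x * iexp (\<theta> * G x) \<partial>N)"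
    and A [measurable]: "A \<in> sets borel"
    and frontier: "measure N {x \<in> space N. G x \<in> frontier A} = 0"
  shows "(\<lambda>d. \<integral>x. W d x * indicator A (Y d x) \<partial>M) \<longlonglongrightarrow> (\<integral>x. V x * indicator A (G x) \<partial>N)"
proof -
  interpret M: prob_space M by fact
  interpret N: prob_space N by fact
  define w where "w d = (\<integral>x. W d x \<partial>M)" for d
  define v where "v = (\<integral>x. V x \<partial>N)"
  have iW: "integrable M (\<lambda>x. W d x)" for d
    by (rule M.integrable_const_bound[where B=B]) (auto simp: W0 WB)
  have iV: "integrable N V"
    by (rule N.integrable_const_bound[where B=B]) (auto simp: V0 VB)
  have iWA: "integrable M (\<lambda>x. W d x * indicator A (Y d x))" for d
    by (rule M.integrable_const_bound[where B=B]) (auto simp: W0 WB indicator_def intro: order_trans[OF W0 WB])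
  have iVA: "integrable N (\<lambda>x. V x * indicator A (G x))"
    by (rule N.integrable_const_bound[where B=B]) (auto simp: V0 VB indicator_def intro: order_trans[OF V0 VB])
  have w0: "w d \<ge> 0" for d unfolding w_def by (intro integral_nonneg_AE) (auto simp: W0)
  have v0: "v \<ge> 0" unfolding v_def by (intro integral_nonneg_AE) (auto simp: V0)
  have Ww: "(\<integral>x. W d x * indicator A (Y d x) \<partial>M) \<le> w d" for d unfolding w_def
    by (intro integral_mono iW iWA) (auto simp: indicator_def W0)
  have Vv: "(\<integral>x. V x * indicator A (G x) \<partial>N) \<le> v" unfolding v_def
    by (intro integral_mono iV iVA) (auto simp: indicator_def V0)
  have "(\<lambda>d. complex_of_real (w d)) \<longlonglongrightarrow> complex_of_real v"
    using char[of 0] by (simp add: w_def v_def)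
  then have wv: "w \<longlonglongrightarrow> v" by (simp add: tendsto_of_real_iff)
  show ?thesis
  proof (cases "v = 0")
    \<comment> \<open>A limit of total mass 0 cannot be normalised; there the integrals are squeezed
      between 0 and \<open>w d\<close>, which tends to 0.\<close>
    case True
    have V': "(\<integral>x. V x * indicator A (G x) \<partial>N) = 0"
      using Vv True by (intro antisym integral_nonneg_AE) (auto simp: V0)
    show ?thesis unfolding V'
      by (rule tendsto_sandwich[OF _ _ tendsto_const wv[unfolded True]])
        (auto simp: Ww W0 intro!: always_eventually integral_nonneg_AE)
  next
    case False
    then have vp: "v > 0" using v0 by simp
    \<comment> \<open>\<open>w d\<close> can vanish for finitely many \<open>d\<close> only; the
      point mass is a filler that makes every \<open>\<mu> d\<close> a distribution, as the
      continuity theorem requires.\<close>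
    define \<mu> where "\<mu> d = (if w d > 0 then distr (density M (\<lambda>x. W d x / w d)) borel (Y d) else return borel 0)" for d
    define \<mu>' where "\<mu>' = distr (density N (\<lambda>x. V x / v)) borel G"
    have norm: "prob_space (density M (\<lambda>x. W d x / w d))" if "w d > 0" for d
    proof
      have "(\<integral>\<^sup>+x. ennreal (W d x / w d) \<partial>M) = ennreal (\<integral>x. W d x / w d \<partial>M)"
        using iW W0 w0 by (intro nn_integral_eq_integral) auto
      then show "emeasure (density M (\<lambda>x. W d x / w d)) (space (density M (\<lambda>x. W d x / w d))) = 1"
        using that by (simp add: emeasure_density w_def)
    qed
    have norm': "prob_space (density N (\<lambda>x. V x / v))"
    proof
      have "(\<integral>\<^sup>+x. ennreal (V x / v) \<partial>N) = ennreal (\<integral>x. V x / v \<partial>N)"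
        using iV V0 v0 by (intro nn_integral_eq_integral) auto
      then show "emeasure (density N (\<lambda>x. V x / v)) (space (density N (\<lambda>x. V x / v))) = 1"
        using vp by (simp add: emeasure_density v_def)
    qed
    have rd: "real_distribution (\<mu> d)" for d
    proof (cases "w d > 0")
      case True
      then interpret D: prob_space "density M (\<lambda>x. W d x / w d)" by (rule norm)
      show ?thesis using True by (auto simp: \<mu>_def intro!: D.real_distribution_distr)
    qed (auto simp: \<mu>_def real_distribution_def real_distribution_axioms_def intro: prob_space_return)
    interpret D': prob_space "density N (\<lambda>x. V x / v)" by (rule norm')
    have rd': "real_distribution \<mu>'"
      by (auto simp: \<mu>'_def intro!: D'.real_distribution_distr)
    have ev: "eventually (\<lambda>d. w d > 0) sequentially"
      using order_tendstoD(1)[OF wv vp] .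
    have int: "(\<integral>x. f x \<partial>\<mu> d) = (\<integral>x. W d x *\<^sub>R f (Y d x) \<partial>M) /\<^sub>R w d"
      if "w d > 0" and [measurable]: "f \<in> borel_measurable borel" for d and f :: "real \<Rightarrow> 'c::{banach,second_countable_topology}"
    proof -
      have "(\<integral>x. f x \<partial>\<mu> d) = (\<integral>x. (W d x / w d) *\<^sub>R f (Y d x) \<partial>M)"
        using that W0 w0 by (simp add: \<mu>_def integral_distr integral_density)
      also have "\<dots> = (\<integral>x. inverse (w d) *\<^sub>R (W d x *\<^sub>R f (Y d x)) \<partial>M)"
        by (simp add: divide_inverse mult.commute)
      finally show ?thesis by (simp only: integral_scaleR_right)
    qed
    have int': "(\<integral>x. f x \<partial>\<mu>') = (\<integral>x. V x *\<^sub>R f (G x) \<partial>N) /\<^sub>R v"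
      if [measurable]: "f \<in> borel_measurable borel" for f :: "real \<Rightarrow> 'c::{banach,second_countable_topology}"
    proof -
      have "(\<integral>x. f x \<partial>\<mu>') = (\<integral>x. (V x / v) *\<^sub>R f (G x) \<partial>N)"
        using that V0 v0 by (simp add: \<mu>'_def integral_distr integral_density)
      also have "\<dots> = (\<integral>x. inverse v *\<^sub>R (V x *\<^sub>R f (G x)) \<partial>N)"
        by (simp add: divide_inverse mult.commute)
      finally show ?thesis by (simp only: integral_scaleR_right)
    qed
    have "(\<lambda>d. char (\<mu> d) \<theta>) \<longlonglongrightarrow> char \<mu>' \<theta>" for \<theta>
    proof -
      have "(\<lambda>d. (\<integral>x. W d x * iexp (\<theta> * Y d x) \<partial>M) /\<^sub>R w d) \<longlonglongrightarrow> (\<integral>x. V x * iexp (\<theta> * G x) \<partial>N) /\<^sub>R v"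
        using vp by (intro tendsto_intros char wv) auto
      then have "(\<lambda>d. (\<integral>x. W d x * iexp (\<theta> * Y d x) \<partial>M) /\<^sub>R w d) \<longlonglongrightarrow> char \<mu>' \<theta>"
        by (simp add: char_def int' scaleR_conv_of_real)
      moreover have "\<forall>\<^sub>F d in sequentially. (\<integral>x. W d x * iexp (\<theta> * Y d x) \<partial>M) /\<^sub>R w d = char (\<mu> d) \<theta>"
        using ev by eventually_elim (simp add: char_def int scaleR_conv_of_real)
      ultimately show ?thesis by (rule Lim_transform_eventually)
    qed
    then have wc: "weak_conv_m \<mu> \<mu>'" by (intro levy_continuity rd rd')
    interpret R': real_distribution \<mu>' by (rule rd')
    have meas: "measure \<mu>' B = (\<integral>x. V x * indicator B (G x) \<partial>N) / v" if "B \<in> sets borel" for B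
    proof -
      have "measure \<mu>' B = (\<integral>x. indicator B x \<partial>\<mu>')" using that by simp
      also have "\<dots> = (\<integral>x. V x * indicator B (G x) \<partial>N) / v"
        using that by (subst int') (auto simp: field_simps)
      finally show ?thesis .
    qed
    have fr: "emeasure \<mu>' (frontier A) = 0"
    proof -
      have [measurable]: "frontier A \<in> sets borel" by (intro borel_closed frontier_closed)
      have "AE x in N. G x \<notin> frontier A"
        using frontier by (subst AE_iff_measurable[OF _ refl]) (auto simp: N.emeasure_eq_measure)
      then have "(\<integral>x. V x * indicator (frontier A) (G x) \<partial>N) = 0"
        by (intro integral_eq_zero_AE) auto
      then show ?thesis using meas[of "frontier A"] by (simp add: R'.emeasure_eq_measure)
    qed
    have "(\<lambda>d. measure (\<mu> d) A) \<longlonglongrightarrow> measure \<mu>' A"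
      by (rule weak_conv_imp_continuity_set_conv[OF rd rd' wc A]) (use fr in simp)
    then have "(\<lambda>d. measure (\<mu> d) A * w d) \<longlonglongrightarrow> measure \<mu>' A * v"
      by (intro tendsto_intros wv)
    moreover have "measure \<mu>' A * v = (\<integral>x. V x * indicator A (G x) \<partial>N)"
      using meas[OF A] vp by simp
    moreover have "\<forall>\<^sub>F d in sequentially. measure (\<mu> d) A * w d = (\<integral>x. W d x * indicator A (Y d x) \<partial>M)"
      using ev
    proof eventually_elim
      case (elim d)
      interpret R: real_distribution "\<mu> d" by (rule rd)
      have "measure (\<mu> d) A = (\<integral>x. indicator A x \<partial>\<mu> d)" by simp
      then show ?case using elim by (subst (asm) int) (auto simp: field_simps)
    qed
    ultimately show ?thesis by (simp add: Lim_transform_eventually)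
  qed
qed

text \<open>Adding 1 to \<open>cos\<close> and \<open>sin\<close> makes all weights nonnegative, so
  that they can serve as densities; subtracting the integral with weight \<open>f\<close> alone
  undoes the shift in the real and the imaginary part.\<close>

lemma (in prob_space) integral_indicator_iexp:
  fixes f g h :: "'a \<Rightarrow> real"
  assumes [measurable]: "f \<in> borel_measurable M" "g \<in> borel_measurable M" "h \<in> borel_measurable M" "A \<in> sets borel"
    and b: "\<And>x. 0 \<le> f x" "\<And>x. f x \<le> 1"
  defines "J z \<equiv> (\<integral>x. f x * z x * indicator A (g x) \<partial>M)"
  shows "(\<integral>x. f x * indicator A (g x) * iexp (h x) \<partial>M) =
      complex_of_real (J (\<lambda>x. 1 + cos (h x)) - J (\<lambda>_. 1)) + \<i> * complex_of_real (J (\<lambda>x. 1 + sin (h x)) - J (\<lambda>_. 1))"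
proof -
  have i0: "integrable M (\<lambda>x. f x * indicator A (g x) * z (h x))"
    if [measurable]: "z \<in> borel_measurable borel" and z: "\<And>y. \<bar>z y\<bar> \<le> 1" for z :: "real \<Rightarrow> real"
  proof (rule integrable_const_bound[where B=1])
    show "AE x in M. norm (f x * indicator A (g x) * z (h x)) \<le> 1"
      using b z by (auto simp: abs_mult indicator_def intro!: mult_le_one)
  qed measurable
  have i1: "integrable M (\<lambda>x. f x * indicator A (g x))" using i0[of "\<lambda>_. 1"] by simp
  have ic: "integrable M (\<lambda>x. f x * indicator A (g x) * cos (h x))" by (rule i0) auto
  have is1: "integrable M (\<lambda>x. f x * indicator A (g x) * sin (h x))" by (rule i0) auto
  have "(\<integral>x. f x * indicator A (g x) * iexp (h x) \<partial>M) =
    (\<integral>x. of_real (f x * indicator A (g x) * cos (h x)) + \<i> * of_real (f x * indicator A (g x) * sin (h x)) \<partial>M)"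
    unfolding cis_conv_exp[symmetric]
    by (intro Bochner_Integration.integral_cong refl) (auto simp: complex_eq_iff indicator_def)
  also have "\<dots> = of_real (\<integral>x. f x * indicator A (g x) * cos (h x) \<partial>M) +
      \<i> * of_real (\<integral>x. f x * indicator A (g x) * sin (h x) \<partial>M)"
    using ic is1 by (subst Bochner_Integration.integral_add) (simp_all only: integral_mult_right_zero integral_complex_of_real integrable_mult_right integrable_of_real)
  also have "(\<integral>x. f x * indicator A (g x) * cos (h x) \<partial>M) = J (\<lambda>x. 1 + cos (h x)) - J (\<lambda>_. 1)"
  proof -
    have "J (\<lambda>x. 1 + cos (h x)) = (\<integral>x. f x * indicator A (g x) + f x * indicator A (g x) * cos (h x) \<partial>M)"
      unfolding J_def by (intro Bochner_Integration.integral_cong refl) (simp add: algebra_simps)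
    then show ?thesis using ic i1 by (simp add: J_def)
  qed
  also have "(\<integral>x. f x * indicator A (g x) * sin (h x) \<partial>M) = J (\<lambda>x. 1 + sin (h x)) - J (\<lambda>_. 1)"
  proof -
    have "J (\<lambda>x. 1 + sin (h x)) = (\<integral>x. f x * indicator A (g x) + f x * indicator A (g x) * sin (h x) \<partial>M)"
      unfolding J_def by (intro Bochner_Integration.integral_cong refl) (simp add: algebra_simps)
    then show ?thesis using is1 i1 by (simp add: J_def)
  qed
  finally show ?thesis .
qed

lemma (in prob_space) integral_prod_indicator:
  assumes "finite I" and [measurable]: "\<And>e. Z e \<in> borel_measurable M" "\<And>e. A e \<in> sets borel"
  shows "(\<integral>x. of_real (\<Prod>e\<in>I. indicator (A e) (Z e x)) \<partial>M) = complex_of_real (prob {x \<in> space M. \<forall>e\<in>I. Z e x \<in> A e})"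
proof -
  have "(\<integral>x. of_real (\<Prod>e\<in>I. indicator (A e) (Z e x)) \<partial>M) =
    complex_of_real (\<integral>x. (\<Prod>e\<in>I. indicator (A e) (Z e x)) \<partial>M)" by (rule integral_complex_of_real)
  also have "(\<integral>x. (\<Prod>e\<in>I. indicator (A e) (Z e x)) \<partial>M) = (\<integral>x. indicator {x \<in> space M. \<forall>e\<in>I. Z e x \<in> A e} x \<partial>M :: real)"
  proof (intro Bochner_Integration.integral_cong refl)
    fix x assume "x \<in> space M"
    then show "(\<Prod>e\<in>I. indicator (A e) (Z e x)) = (indicator {x \<in> space M. \<forall>e\<in>I. Z e x \<in> A e} x :: real)"
      using assms by (auto simp: indicator_def)
  qed
  also have "\<dots> = measure M {x \<in> space M. \<forall>e\<in>I. Z e x \<in> A e}"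
    using assms by (subst Bochner_Integration.integral_indicator) (auto intro!: arg_cong[where f="measure M"])
  finally show ?thesis .
qed

text \<open>A complex weight \<open>P e\<^sup>i\<^sup>\<psi>\<close> is a combination of the nonnegative weights \<open>P\<close>,
  \<open>P (1 + cos \<psi>)\<close> and \<open>P (1 + sin \<psi>)\<close>.\<close>

lemma weighted_levy_continuity_iexp:
  fixes Y P \<psi> :: "nat \<Rightarrow> 'a \<Rightarrow> real" and G Q \<phi> :: "'b \<Rightarrow> real"
  assumes M: "prob_space M" and N: "prob_space N"
    and Y [measurable]: "\<And>d. Y d \<in> borel_measurable M" and G [measurable]: "G \<in> borel_measurable N"
    and P [measurable]: "\<And>d. P d \<in> borel_measurable M" and Q [measurable]: "Q \<in> borel_measurable N"
    and \<psi> [measurable]: "\<And>d. \<psi> d \<in> borel_measurable M" and \<phi> [measurable]: "\<phi> \<in> borel_measurable N"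
    and P01: "\<And>d x. P d x \<in> {0..1}" and Q01: "\<And>x. Q x \<in> {0..1}"
    and conv: "\<And>\<eta> c. (\<lambda>d. \<integral>x. P d x * iexp (\<eta> * Y d x + c * \<psi> d x) \<partial>M)
                 \<longlonglongrightarrow> (\<integral>x. Q x * iexp (\<eta> * G x + c * \<phi> x) \<partial>N)"
    and A [measurable]: "A \<in> sets borel"
    and frontier: "measure N {x \<in> space N. G x \<in> frontier A} = 0"
  shows "(\<lambda>d. \<integral>x. P d x * indicator A (Y d x) * iexp (\<psi> d x) \<partial>M)
           \<longlonglongrightarrow> (\<integral>x. Q x * indicator A (G x) * iexp (\<phi> x) \<partial>N)"
proof -
  interpret M: prob_space M by fact
  interpret N: prob_space N by fact
  have bP: "norm (complex_of_real (P d x)) \<le> 1" "P d x \<ge> 0" "P d x \<le> 1" for d x using P01[of d x] by auto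
  have bQ: "norm (complex_of_real (Q x)) \<le> 1" "Q x \<ge> 0" "Q x \<le> 1" for x using Q01[of x] by auto
  have iP: "integrable M (\<lambda>x. P d x * iexp (\<eta> * Y d x + c * \<psi> d x))" for d \<eta> c
    by (rule M.integrable_const_bound[where B=1]) (auto simp: norm_mult bP)
  have iQ: "integrable N (\<lambda>x. Q x * iexp (\<eta> * G x + c * \<phi> x))" for \<eta> c
    by (rule N.integrable_const_bound[where B=1]) (auto simp: norm_mult bQ)
  have range: "0 \<le> p * (1 + z)" "p * (1 + z) \<le> 2" if "0 \<le> p" "p \<le> 1" "-1 \<le> z" "z \<le> 1" for p z :: real
    using that mult_mono[of p 1 "1 + z" 2] by auto
  \<comment> \<open>Euler's formulas turn the shifted weights into exponentials with
    \<open>c\<close> equal to 0, 1 and -1, the instances of \<open>conv\<close> that are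
    used.\<close>
  have split_cos: "of_real (p * (1 + cos z)) * iexp (u) =
      p * iexp (u + 0 * z) + (p * iexp (u + 1 * z) + p * iexp (u + (-1) * z)) / 2"
    and split_sin: "of_real (p * (1 + sin z)) * iexp (u) =
      p * iexp (u + 0 * z) + - (\<i> / 2) * (p * iexp (u + 1 * z) - p * iexp (u + (-1) * z))" for p z u :: real
    unfolding cis_conv_exp[symmetric]
    by (auto simp: complex_eq_iff cos_add sin_add cos_diff sin_diff field_simps)
  have "(\<lambda>d. \<integral>x. P d x * indicator A (Y d x) \<partial>M) \<longlonglongrightarrow> (\<integral>x. Q x * indicator A (G x) \<partial>N)"
    by (rule weighted_levy_continuity[OF M N, where B=1])
      (use frontier conv[where c=0] in \<open>auto simp: bP bQ\<close>)
  note L0 = this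
  have "(\<lambda>d. \<integral>x. P d x * (1 + cos (\<psi> d x)) * indicator A (Y d x) \<partial>M)
    \<longlonglongrightarrow> (\<integral>x. Q x * (1 + cos (\<phi> x)) * indicator A (G x) \<partial>N)"
  proof (rule weighted_levy_continuity[OF M N, where B=2])
    fix \<theta>
    show "(\<lambda>d. \<integral>x. of_real (P d x * (1 + cos (\<psi> d x))) * iexp (\<theta> * Y d x) \<partial>M)
      \<longlonglongrightarrow> (\<integral>x. of_real (Q x * (1 + cos (\<phi> x))) * iexp (\<theta> * G x) \<partial>N)"
      unfolding split_cos
      by (simp only: Bochner_Integration.integral_add Bochner_Integration.integral_diff integral_divide_zero iP iQ
        Bochner_Integration.integrable_add integrable_divide)
       (intro tendsto_add tendsto_divide tendsto_const conv, simp)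
  next
    fix d x show "0 \<le> P d x * (1 + cos (\<psi> d x))" "P d x * (1 + cos (\<psi> d x)) \<le> 2"
      by (intro range bP cos_ge_minus_one cos_le_one sin_ge_minus_one sin_le_one)+
  next
    fix x show "0 \<le> Q x * (1 + cos (\<phi> x))" "Q x * (1 + cos (\<phi> x)) \<le> 2"
      by (intro range bQ cos_ge_minus_one cos_le_one sin_ge_minus_one sin_le_one)+
  qed (use frontier in auto)
  note L1 = this
  have "(\<lambda>d. \<integral>x. P d x * (1 + sin (\<psi> d x)) * indicator A (Y d x) \<partial>M)
    \<longlonglongrightarrow> (\<integral>x. Q x * (1 + sin (\<phi> x)) * indicator A (G x) \<partial>N)"
  proof (rule weighted_levy_continuity[OF M N, where B=2])
    fix \<theta>
    show "(\<lambda>d. \<integral>x. of_real (P d x * (1 + sin (\<psi> d x))) * iexp (\<theta> * Y d x) \<partial>M)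
      \<longlonglongrightarrow> (\<integral>x. of_real (Q x * (1 + sin (\<phi> x))) * iexp (\<theta> * G x) \<partial>N)"
      unfolding split_sin
      by (simp only: Bochner_Integration.integral_add Bochner_Integration.integral_diff integral_mult_right_zero iP iQ
        Bochner_Integration.integrable_diff integrable_mult_right)
       (intro tendsto_add tendsto_diff tendsto_mult tendsto_const conv)
  next
    fix d x show "0 \<le> P d x * (1 + sin (\<psi> d x))" "P d x * (1 + sin (\<psi> d x)) \<le> 2"
      by (intro range bP cos_ge_minus_one cos_le_one sin_ge_minus_one sin_le_one)+
  next
    fix x show "0 \<le> Q x * (1 + sin (\<phi> x))" "Q x * (1 + sin (\<phi> x)) \<le> 2"
      by (intro range bQ cos_ge_minus_one cos_le_one sin_ge_minus_one sin_le_one)+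
  qed (use frontier in auto)
  note L2 = this
  show ?thesis
    unfolding M.integral_indicator_iexp[OF P Y \<psi> A bP(2,3)] N.integral_indicator_iexp[OF Q G \<phi> A bQ(2,3)] mult_1_right
    by (intro tendsto_intros L0 L1 L2)
qed

text \<open>Passage from joint characteristic functions to probabilities of rectangles, with the
  continuity theorem applied to one real coordinate at a time; hence the boundary condition concerns
  each side \<open>A e\<close> separately.\<close>

lemma prob_tendsto_of_iexp_tendsto:
  fixes Y :: "nat \<Rightarrow> 'e \<Rightarrow> 'a \<Rightarrow> real" and G :: "'e \<Rightarrow> 'b \<Rightarrow> real" and A :: "'e \<Rightarrow> real set"
  assumes M: "prob_space M" and N: "prob_space N" and I: "finite I"
    and Y [measurable]: "\<And>d e. Y d e \<in> borel_measurable M" and G [measurable]: "\<And>e. G e \<in> borel_measurable N"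
    and A [measurable]: "\<And>e. A e \<in> sets borel"
    and frontier: "\<And>e. e \<in> I \<Longrightarrow> measure N {x \<in> space N. G e x \<in> frontier (A e)} = 0"
    and iexp: "\<And>\<theta>. (\<lambda>d. \<integral>x. iexp (\<Sum>e\<in>I. \<theta> e * Y d e x) \<partial>M) \<longlonglongrightarrow> (\<integral>x. iexp (\<Sum>e\<in>I. \<theta> e * G e x) \<partial>N)"
  shows "(\<lambda>d. measure M {x \<in> space M. \<forall>e\<in>I. Y d e x \<in> A e}) \<longlonglongrightarrow> measure N {x \<in> space N. \<forall>e\<in>I. G e x \<in> A e}"
proof -
  interpret M: prob_space M by fact
  interpret N: prob_space N by fact
  \<comment> \<open>The exponential factors are replaced by indicators one coordinate at a time.\<close>
  have claim: "(\<lambda>d. \<integral>x. of_real (\<Prod>e\<in>J. indicator (A e) (Y d e x)) * iexp (\<Sum>e\<in>I-J. \<theta> e * Y d e x) \<partial>M)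
       \<longlonglongrightarrow> (\<integral>x. of_real (\<Prod>e\<in>J. indicator (A e) (G e x)) * iexp (\<Sum>e\<in>I-J. \<theta> e * G e x) \<partial>N)"
    if "J \<subseteq> I" for J \<theta>
    using finite_subset[OF that I] that
  proof (induction J arbitrary: \<theta>)
    case empty
    then show ?case using iexp by simp
  next
    case (insert a J)
    let ?P = "\<lambda>Z x. \<Prod>e\<in>J. indicator (A e) (Z e x) :: real"
    have P01: "(\<Prod>e\<in>J. indicator (A e) (z e)) \<in> {0..1::real}" for z
      by (auto intro!: prod_nonneg prod_le_1)
    \<comment> \<open>The induction hypothesis holds for every \<open>\<theta>\<close>: giving
      coordinate \<open>a\<close> its own frequency \<open>\<eta>\<close> and scaling the others by
      \<open>c\<close> yields the two-parameter family that the one-coordinate step needs.\<close>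
    have sums: "(\<Sum>e\<in>I - J. (if e = a then \<eta> else c * \<theta> e) * z e) = \<eta> * z a + c * (\<Sum>e\<in>I - insert a J. \<theta> e * z e)"
      for \<eta> c and z :: "'e \<Rightarrow> real"
    proof -
      have eq: "I - J = insert a (I - insert a J)" using insert.hyps insert.prems by auto
      have "(\<Sum>e\<in>I - J. (if e = a then \<eta> else c * \<theta> e) * z e) =
        \<eta> * z a + (\<Sum>e\<in>I - insert a J. (if e = a then \<eta> else c * \<theta> e) * z e)"
        by (subst eq, subst sum.insert) (use I in simp_all)
      also have "(\<Sum>e\<in>I - insert a J. (if e = a then \<eta> else c * \<theta> e) * z e) = c * (\<Sum>e\<in>I - insert a J. \<theta> e * z e)"
        unfolding sum_distrib_left by (intro sum.cong) auto
      finally show ?thesis .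
    qed
    have "(\<lambda>d. \<integral>x. of_real (?P (Y d) x * indicator (A a) (Y d a x)) * iexp (\<Sum>e\<in>I-insert a J. \<theta> e * Y d e x) \<partial>M)
       \<longlonglongrightarrow> (\<integral>x. of_real (?P G x * indicator (A a) (G a x)) * iexp (\<Sum>e\<in>I-insert a J. \<theta> e * G e x) \<partial>N)"
    proof (rule weighted_levy_continuity_iexp[OF M N])
      fix \<eta> c
      show "(\<lambda>d. \<integral>x. of_real (?P (Y d) x) * iexp (\<eta> * Y d a x + c * (\<Sum>e\<in>I - insert a J. \<theta> e * Y d e x)) \<partial>M)
         \<longlonglongrightarrow> (\<integral>x. of_real (?P G x) * iexp (\<eta> * G a x + c * (\<Sum>e\<in>I - insert a J. \<theta> e * G e x)) \<partial>N)"
        using insert.IH[of "\<lambda>e. if e = a then \<eta> else c * \<theta> e", unfolded sums] insert.prems by blast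
    next
      show "?P (Y d) x \<in> {0..1}" for d x by (rule P01)
      show "?P G x \<in> {0..1}" for x by (rule P01)
      show "?P (Y d) \<in> borel_measurable M" for d by measurable
      show "?P G \<in> borel_measurable N" by measurable
      show "measure N {x \<in> space N. G a x \<in> frontier (A a)} = 0"
        using insert.prems frontier by simp
    qed measurable
    moreover have "of_real (\<Prod>e\<in>insert a J. indicator (A e) (z e)) = (of_real ((\<Prod>e\<in>J. indicator (A e) (z e)) * indicator (A a) (z a)) :: complex)" for z
      using insert.hyps by (simp add: mult.commute)
    ultimately show ?case by (simp only:)
  qed
  have "(\<lambda>d. complex_of_real (M.prob {x \<in> space M. \<forall>e\<in>I. Y d e x \<in> A e}))
      \<longlonglongrightarrow> complex_of_real (N.prob {x \<in> space N. \<forall>e\<in>I. G e x \<in> A e})"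
    using claim[OF subset_refl]
    unfolding M.integral_prod_indicator[OF I Y A, symmetric] N.integral_prod_indicator[OF I G A, symmetric]
      Diff_cancel sum.empty of_real_0 mult_zero_right exp_zero mult_1_right .
  then show ?thesis by (simp only: tendsto_of_real_iff)
qed

section \<open>Orthogonal decomposition of the squared distances\<close>

text \<open>The central limit theorem divides by the standard deviation; evaluating the
  characteristic function at \<open>sqrt v\<close> undoes this. Linear combinations may have
  variance 0; then every summand vanishes almost surely, and the integrals and the limit are
  1.\<close>

lemma (in prob_space) iexp_scaled_sum_tendsto:
  fixes X :: "nat \<Rightarrow> 'a \<Rightarrow> real"
  assumes indep: "indep_vars (\<lambda>_. borel) X UNIV"
    and mean: "\<And>k. expectation (X k) = 0"
    and sq: "\<And>k. integrable M (\<lambda>x. (X k x)\<^sup>2)"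
    and var: "\<And>k. expectation (\<lambda>x. (X k x)\<^sup>2) = v"
    and distr: "\<And>k. distr M borel (X k) = \<mu>"
  shows "(\<lambda>d. \<integral>x. iexp ((\<Sum>k<d. X k x) / sqrt (real d)) \<partial>M) \<longlonglongrightarrow> complex_of_real (exp (- v / 2))"
proof (cases "v = 0")
  case True
  have [measurable]: "X k \<in> borel_measurable M" for k
    using indep by (simp add: indep_vars_def2)
  have "AE x in M. (X k x)\<^sup>2 = 0" for k
    using integral_nonneg_eq_0_iff_AE[OF sq, of k] var[of k] True by simp
  then have ae: "AE x in M. \<forall>k. X k x = 0" by (simp add: AE_all_countable)
  have "(\<integral>x. iexp ((\<Sum>k<d. X k x) / sqrt (real d)) \<partial>M) = (\<integral>x. 1 \<partial>M)" for d
    by (rule integral_cong_AE) (use ae in \<open>auto elim!: eventually_mono\<close>)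
  then show ?thesis using True by (simp add: prob_space)
next
  case False
  have [measurable]: "X k \<in> borel_measurable M" for k
    using indep by (simp add: indep_vars_def2)
  have "v \<ge> 0" using var[of 0] by (metis integral_nonneg_AE AE_I2 zero_le_power2)
  then have v: "v > 0" using False by simp
  have "weak_conv_m (\<lambda>d. distr M borel (\<lambda>x. (\<Sum>k<d. X k x) / sqrt (d * (sqrt v)\<^sup>2))) std_normal_distribution"
    by (rule central_limit_theorem_zero_mean[OF indep mean _ sq _ distr]) (use v var mean in simp_all)
  then have "(\<lambda>d. char (distr M borel (\<lambda>x. (\<Sum>k<d. X k x) / sqrt (d * (sqrt v)\<^sup>2))) (sqrt v))
      \<longlonglongrightarrow> char std_normal_distribution (sqrt v)"
    by (intro levy_continuity1 real_dist_normal_dist) auto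
  moreover have "char (distr M borel (\<lambda>x. (\<Sum>k<d. X k x) / sqrt (d * (sqrt v)\<^sup>2))) (sqrt v) =
     (\<integral>x. iexp ((\<Sum>k<d. X k x) / sqrt (real d)) \<partial>M)" for d
    unfolding char_def using v by (subst integral_distr) (auto simp: real_sqrt_mult)
  moreover have "char std_normal_distribution (sqrt v) = complex_of_real (exp (- v / 2))"
    using v by (simp add: char_std_normal_distribution)
  ultimately show ?thesis by simp
qed

lemma indep_vars_PiM_coordinates:
  assumes "\<And>i. i \<in> I \<Longrightarrow> prob_space (M i)" "I \<noteq> {}"
  shows "prob_space.indep_vars (PiM I M) M (\<lambda>i \<omega>. \<omega> i) I"
proof -
  interpret prob_space "PiM I M" by (rule prob_space_PiM) fact
  have "distr (PiM I M) (PiM I M) (\<lambda>x. restrict x I) = distr (PiM I M) (PiM I M) (\<lambda>x. x)"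
    by (intro distr_cong) (auto simp: space_PiM)
  then show ?thesis using assms
    by (subst indep_vars_iff_distr_eq_PiM') (auto simp: distr_PiM_component cong: PiM_cong)
qed

section \<open>Orthogonal features of one coordinate\<close>

locale cube_coordinate = prob_space \<pi> for \<pi> :: "real measure" +
  assumes sets_coordinate: "sets \<pi> = sets (restrict_space borel {0..1})"
begin

lemma space_coordinate: "space \<pi> = {0..1}"
  using sets_eq_imp_space_eq[OF sets_coordinate] by (simp add: space_restrict_space)

lemma borel_measurable_coordinate [measurable (raw)]:
  assumes "f \<in> borel_measurable borel"
  shows "f \<in> borel_measurable \<pi>"
  using assms by (simp add: measurable_cong_sets[OF sets_coordinate refl] measurable_restrict_space1)

lemma borel_measurable_component:
  "p \<in> I \<Longrightarrow> (\<lambda>\<omega>. \<omega> p) \<in> borel_measurable (PiM I (\<lambda>_. \<pi>))"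
proof -
  assume "p \<in> I"
  then have "(\<lambda>\<omega>. \<omega> p) \<in> measurable (PiM I (\<lambda>_. \<pi>)) \<pi>"
    by (rule measurable_component_singleton)
  moreover have "(\<lambda>x. x) \<in> borel_measurable \<pi>"
    by (rule borel_measurable_coordinate) simp
  ultimately show ?thesis by (rule measurable_compose)
qed

lemma integrable_continuous:
  fixes f :: "real \<Rightarrow> real"
  assumes "continuous_on UNIV f"
  shows "integrable \<pi> f"
proof -
  have "compact (f ` {0..1})"
    by (intro compact_continuous_image continuous_on_subset[OF assms]) auto
  then obtain B where "\<forall>y\<in>f ` {0..1}. norm y \<le> B"
    using compact_imp_bounded bounded_iff by metis
  then show ?thesis
    by (intro integrable_const_bound[where B=B])
      (auto simp: space_coordinate intro!: AE_I2 borel_measurable_coordinate borel_measurable_continuous_onI assms)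
qed

abbreviation "mean \<equiv> expectation (\<lambda>x. x)"
abbreviation "var \<equiv> central_moment \<pi> 2"

text \<open>The orthogonal family is indexed by vertex sets: the singleton \<open>{i}\<close> stands for
  \<open>u\<^sub>i\<^sup>2 - s\<close> and the pair \<open>{i, j}\<close> for \<open>u\<^sub>i u\<^sub>j\<close>.\<close>

definition factor :: "nat \<Rightarrow> real \<Rightarrow> real" where
  "factor c x = (if c = 1 then (x - mean)\<^sup>2 - var else x - mean)"

definition feature :: "nat set \<Rightarrow> (nat \<Rightarrow> real) \<Rightarrow> real" where
  "feature a x = (\<Prod>i\<in>a. factor (card a) (x i))"

text \<open>For a singleton this is the variance of the squared centred coordinate; for a pair it is
  the product of two variances, by independence.\<close>

definition feature_var :: "nat set \<Rightarrow> real" where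
  "feature_var a = (if card a = 1 then central_moment \<pi> 4 - var\<^sup>2 else var\<^sup>2)"

lemma continuous_factor: "continuous_on UNIV (factor c)"
  unfolding factor_def by (cases "c = 1") (auto intro!: continuous_intros)

lemma integral_factor: "expectation (factor c) = 0"
proof (cases "c = 1")
  case True
  have "integrable \<pi> (\<lambda>x. (x - mean)\<^sup>2)" by (intro integrable_continuous continuous_intros)
  then show ?thesis using True by (simp add: factor_def[abs_def] prob_space central_moment_def)
next
  case False
  have "integrable \<pi> (\<lambda>x. x)" by (intro integrable_continuous continuous_intros)
  then show ?thesis using False by (simp add: factor_def[abs_def] prob_space)
qed

lemma integral_factor_sq:
  "expectation (\<lambda>x. (factor c x)\<^sup>2) = (if c = 1 then central_moment \<pi> 4 - var\<^sup>2 else var)"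
proof (cases "c = 1")
  case True
  have i: "integrable \<pi> (\<lambda>x. (x - mean)^k)" for k by (intro integrable_continuous continuous_intros)
  have "(z\<^sup>2 - v)\<^sup>2 = z ^ 4 - 2 * v * z\<^sup>2 + v\<^sup>2" for z v :: real
    by (simp add: power2_eq_square power4_eq_xxxx algebra_simps)
  then have "(factor c x)\<^sup>2 = (x - mean)^4 - 2 * var * (x - mean)^2 + var\<^sup>2" for x
    using True by (simp add: factor_def)
  then show ?thesis using True i[of 4] i[of 2]
    by (simp add: prob_space) (simp add: central_moment_def power2_eq_square)
next
  case False
  then show ?thesis by (simp add: factor_def[abs_def] central_moment_def)
qed

definition index_sets :: "nat \<Rightarrow> nat set set" where
  "index_sets n = {a. a \<subseteq> {1..n} \<and> (card a = 1 \<or> card a = 2)}"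

lemma finite_index_sets: "finite (index_sets n)"
  unfolding index_sets_def by simp

lemma product_prob_space_coordinates: "product_prob_space (\<lambda>_. \<pi>)"
  by unfold_locales

text \<open>Padding with factors 1 outside \<open>a\<close> makes the feature a product over all
  vertices, so its integral factorises; \<open>a\<close> is nonempty and each of its factors is
  centred.\<close>

lemma
  assumes "a \<in> index_sets n"
  shows integrable_feature: "integrable (PiM {1..n} (\<lambda>_. \<pi>)) (feature a)"
    and integral_feature: "(\<integral>x. feature a x \<partial>PiM {1..n} (\<lambda>_. \<pi>)) = 0"
proof -
  interpret product_prob_space "\<lambda>_. \<pi>" by (rule product_prob_space_coordinates)
  define g where "g i y = (if i \<in> a then factor (card a) y else 1)" for i y
  have i: "integrable \<pi> (g i)" for i
    unfolding g_def by (cases "i \<in> a") (auto intro!: integrable_continuous continuous_factor)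
  have a: "a \<subseteq> {1..n}" "a \<noteq> {}" using assms by (auto simp: index_sets_def)
  have eq: "feature a = (\<lambda>x. \<Prod>i\<in>{1..n}. g i (x i))"
    unfolding feature_def g_def using a by (auto simp: prod.If_cases Int_absorb1 fun_eq_iff)
  show "integrable (PiM {1..n} (\<lambda>_. \<pi>)) (feature a)"
    unfolding eq by (intro product_integrable_prod i) auto
  have "(\<integral>x. feature a x \<partial>PiM {1..n} (\<lambda>_. \<pi>)) = (\<Prod>i\<in>{1..n}. integral\<^sup>L \<pi> (g i))"
    unfolding eq by (intro product_integral_prod i) auto
  also have "\<dots> = 0"
  proof -
    obtain i where "i \<in> a" using a by auto
    then have "g i = factor (card a)" by (auto simp: g_def)
    then show ?thesis using \<open>i \<in> a\<close> a integral_factor by (intro prod_zero bexI[of _ i]) auto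
  qed
  finally show "(\<integral>x. feature a x \<partial>PiM {1..n} (\<lambda>_. \<pi>)) = 0" .
qed

text \<open>A vertex in the symmetric difference of \<open>a\<close> and \<open>b\<close>
  contributes one centred factor alone, which annihilates the product. This also separates a
  singleton from a pair containing it, although both involve the same coordinate.\<close>

lemma
  assumes "a \<in> index_sets n" "b \<in> index_sets n"
  shows integrable_feature_mult: "integrable (PiM {1..n} (\<lambda>_. \<pi>)) (\<lambda>x. feature a x * feature b x)"
    and integral_feature_mult:
      "(\<integral>x. feature a x * feature b x \<partial>PiM {1..n} (\<lambda>_. \<pi>)) = (if a = b then feature_var a else 0)"
proof -
  have prob_\<pi>: "measure \<pi> (space \<pi>) = 1" by (rule prob_space)
  interpret product_prob_space "\<lambda>_. \<pi>" by (rule product_prob_space_coordinates)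
  define g where "g i y = (if i \<in> a then factor (card a) y else 1) * (if i \<in> b then factor (card b) y else 1)" for i y
  have i: "integrable \<pi> (g i)" for i
    unfolding g_def by (cases "i \<in> a"; cases "i \<in> b") (auto intro!: integrable_continuous continuous_factor continuous_on_mult)
  have a: "a \<subseteq> {1..n}" "b \<subseteq> {1..n}" using assms by (auto simp: index_sets_def)
  have eq: "(\<lambda>x. feature a x * feature b x) = (\<lambda>x. \<Prod>i\<in>{1..n}. g i (x i))"
    unfolding feature_def g_def using a by (auto simp: prod.distrib prod.If_cases Int_absorb1 fun_eq_iff)
  show "integrable (PiM {1..n} (\<lambda>_. \<pi>)) (\<lambda>x. feature a x * feature b x)"
    unfolding eq by (intro product_integrable_prod i) auto
  have E: "(\<integral>x. feature a x * feature b x \<partial>PiM {1..n} (\<lambda>_. \<pi>)) = (\<Prod>i\<in>{1..n}. integral\<^sup>L \<pi> (g i))"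
    unfolding eq by (intro product_integral_prod i) auto
  show "(\<integral>x. feature a x * feature b x \<partial>PiM {1..n} (\<lambda>_. \<pi>)) = (if a = b then feature_var a else 0)"
  proof (cases "a = b")
    case False
    then obtain i where i: "i \<in> a \<and> i \<notin> b \<or> i \<in> b \<and> i \<notin> a" by auto
    then have "g i = factor (card a) \<or> g i = factor (card b)" by (auto simp: g_def)
    then have "integral\<^sup>L \<pi> (g i) = 0" using integral_factor by auto
    then show ?thesis using i a False unfolding E by (auto intro!: prod_zero)
  next
    case True
    have "integral\<^sup>L \<pi> (g i) = (if i \<in> a then integral\<^sup>L \<pi> (\<lambda>y. (factor (card a) y)\<^sup>2) else 1)" for i
      using True by (simp add: g_def[abs_def] power2_eq_square prob_\<pi>)
    then have "(\<Prod>i\<in>{1..n}. integral\<^sup>L \<pi> (g i)) = integral\<^sup>L \<pi> (\<lambda>y. (factor (card a) y)\<^sup>2) ^ card a"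
      using a by (simp add: prod.If_cases Int_absorb1)
    then show ?thesis using True assms unfolding E
      by (auto simp: integral_factor_sq feature_var_def index_sets_def)
  qed
qed

text \<open>By orthogonality only the diagonal of the double sum survives; this quadratic form in
  \<open>c\<close> becomes the exponent of the Gaussian limit.\<close>

lemma
  fixes c :: "nat set \<Rightarrow> real" and n
  defines "f \<equiv> \<lambda>x. \<Sum>a\<in>index_sets n. c a * feature a x"
  shows integral_feature_sum: "(\<integral>x. f x \<partial>PiM {1..n} (\<lambda>_. \<pi>)) = 0"
    and integral_feature_sum_sq: "(\<integral>x. (f x)\<^sup>2 \<partial>PiM {1..n} (\<lambda>_. \<pi>)) = (\<Sum>a\<in>index_sets n. (c a)\<^sup>2 * feature_var a)"
    and integrable_feature_sum_sq: "integrable (PiM {1..n} (\<lambda>_. \<pi>)) (\<lambda>x. (f x)\<^sup>2)"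
proof -
  show "(\<integral>x. f x \<partial>PiM {1..n} (\<lambda>_. \<pi>)) = 0"
    unfolding f_def by (subst Bochner_Integration.integral_sum) (simp_all add: integrable_feature integral_feature del: One_nat_def)
  have eq: "(\<lambda>x. (f x)\<^sup>2) = (\<lambda>x. \<Sum>a\<in>index_sets n. \<Sum>b\<in>index_sets n. c a * c b * (feature a x * feature b x))"
    unfolding f_def by (auto simp: power2_eq_square sum_product fun_eq_iff ac_simps)
  show "integrable (PiM {1..n} (\<lambda>_. \<pi>)) (\<lambda>x. (f x)\<^sup>2)"
    unfolding eq by (intro Bochner_Integration.integrable_sum integrable_mult_right integrable_feature_mult)
  have "(\<integral>x. (f x)\<^sup>2 \<partial>PiM {1..n} (\<lambda>_. \<pi>)) =
     (\<Sum>a\<in>index_sets n. \<Sum>b\<in>index_sets n. c a * c b * (if a = b then feature_var a else 0))"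
    unfolding eq
    by (simp add: Bochner_Integration.integral_sum integral_feature_mult integrable_feature_mult
      Bochner_Integration.integrable_sum del: One_nat_def cong: sum.cong)
  also have "\<dots> = (\<Sum>a\<in>index_sets n. (c a)\<^sup>2 * feature_var a)"
    by (simp add: if_distrib[where f="\<lambda>x. _ * x"] finite_index_sets power2_eq_square cong: if_cong)
  finally show "(\<integral>x. (f x)\<^sup>2 \<partial>PiM {1..n} (\<lambda>_. \<pi>)) = (\<Sum>a\<in>index_sets n. (c a)\<^sup>2 * feature_var a)" .
qed

text \<open>The point \<open>(i, k)\<close> of the grid carries coordinate \<open>k\<close> of vertex \<open>i\<close>, so that all dimensions
  live on one probability space and the columns \<open>k\<close> are independent and identically distributed.\<close>

definition grid :: "(nat \<times> nat \<Rightarrow> real) measure" where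
  "grid = PiM UNIV (\<lambda>_. \<pi>)"

lemma prob_space_grid: "prob_space grid"
  unfolding grid_def by (rule prob_space_PiM) unfold_locales

lemma indep_vars_grid: "prob_space.indep_vars grid (\<lambda>_. \<pi>) (\<lambda>p \<omega>. \<omega> p) UNIV"
  unfolding grid_def by (rule indep_vars_PiM_coordinates) (unfold_locales, auto)

text \<open>Used in both directions of the grid: with the second index fixed it yields one
  coordinate of all vertices, with the first fixed all coordinates of one vertex.\<close>

lemma distr_grid_reindex:
  assumes "inj_on h I"
  shows "distr grid (PiM I (\<lambda>_. \<pi>)) (\<lambda>\<omega>. \<lambda>i\<in>I. \<omega> (h i)) = PiM I (\<lambda>_. \<pi>)"
  unfolding grid_def using assms by (intro distr_PiM_reindex) (auto, unfold_locales)

text \<open>As \<open>c\<close> is arbitrary, this is a multivariate central limit theorem in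
  Cramer-Wold form: the columns contribute independent copies of one feature sum, whose mean and
  variance come from orthogonality.\<close>

lemma iexp_feature_sum_tendsto:
  fixes c :: "nat set \<Rightarrow> real" and n
  defines "f \<equiv> \<lambda>x. \<Sum>a\<in>index_sets n. c a * feature a x"
  shows "(\<lambda>d. \<integral>\<omega>. iexp ((\<Sum>k<d. f (\<lambda>i. \<omega> (i, k))) / sqrt (real d)) \<partial>grid)
     \<longlonglongrightarrow> complex_of_real (exp (- (\<Sum>a\<in>index_sets n. (c a)\<^sup>2 * feature_var a) / 2))"
proof -
  interpret G: prob_space grid by (rule prob_space_grid)
  define P where "P = PiM {1..n} (\<lambda>_. \<pi>)"
  have f_cong: "f x = f y" if "\<And>i. i \<in> {1..n} \<Longrightarrow> x i = y i" for x y
    unfolding f_def feature_def using that by (intro sum.cong arg_cong2[where f="(*)"] prod.cong refl) (auto simp: index_sets_def subset_iff)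
  have f_meas: "(\<lambda>z. f (\<lambda>i. z (h i))) \<in> borel_measurable (PiM K (\<lambda>_. \<pi>))" if "h ` {1..n} \<subseteq> K" for K and h :: "nat \<Rightarrow> 'k"
    unfolding f_def feature_def using that
    by (intro borel_measurable_sum borel_measurable_times borel_measurable_const borel_measurable_prod
        measurable_compose[OF borel_measurable_component borel_measurable_continuous_onI[OF continuous_factor]])
      (auto simp: index_sets_def)
  have fP [measurable]: "f \<in> borel_measurable P" using f_meas[of "\<lambda>i. i" "{1..n}"] by (simp add: P_def)
  have col: "f (\<lambda>i. \<omega> (i, k)) = f (\<lambda>i\<in>{1..n}. \<omega> (i, k))" for \<omega> k by (rule f_cong) auto
  have colm [measurable]: "(\<lambda>\<omega>. \<lambda>i\<in>{1..n}. \<omega> (i, k)) \<in> measurable grid P" for k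
    unfolding P_def grid_def by (intro measurable_restrict measurable_component_singleton) auto
  have P: "distr grid P (\<lambda>\<omega>. \<lambda>i\<in>{1..n}. \<omega> (i, k)) = P" for k
    unfolding P_def by (rule distr_grid_reindex) (auto simp: inj_on_def)
  have int: "(\<integral>\<omega>. z (f (\<lambda>i. \<omega> (i, k))) \<partial>grid) = (\<integral>x. z (f x) \<partial>P)" if [measurable]: "z \<in> borel_measurable borel" for z :: "real \<Rightarrow> real" and k
  proof -
    have "(\<integral>x. z (f x) \<partial>P) = (\<integral>x. z (f x) \<partial>distr grid P (\<lambda>\<omega>. \<lambda>i\<in>{1..n}. \<omega> (i, k)))"
      unfolding P ..
    then show ?thesis by (subst (asm) integral_distr) (simp_all add: col del: One_nat_def)
  qed
  show ?thesis
  proof (rule G.iexp_scaled_sum_tendsto)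
    \<comment> \<open>Columns occupy disjoint parts of the grid, hence are independent; restricting
      to a column loses nothing because \<open>f\<close> reads only the vertices in
      \<open>{1..n}\<close>.\<close>
    have "G.indep_vars (\<lambda>k. PiM ({1..n} \<times> {k}) (\<lambda>_. \<pi>)) (\<lambda>k \<omega>. restrict (\<lambda>p. \<omega> p) ({1..n} \<times> {k})) UNIV"
      by (intro G.indep_vars_restrict[OF indep_vars_grid]) (auto simp: disjoint_family_on_def)
    then have ind: "G.indep_vars (\<lambda>_. borel) (\<lambda>k \<omega>. f (\<lambda>i. restrict (\<lambda>p. \<omega> p) ({1..n} \<times> {k}) (i, k))) UNIV"
      by (rule G.indep_vars_compose2) (intro f_meas, auto)
    have eq: "(\<lambda>k \<omega>. f (\<lambda>i. restrict (\<lambda>p. \<omega> p) ({1..n} \<times> {k}) (i, k))) = (\<lambda>k \<omega>. f (\<lambda>i. \<omega> (i, k)))"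
      by (intro ext f_cong) auto
    show "G.indep_vars (\<lambda>_. borel) (\<lambda>k \<omega>. f (\<lambda>i. \<omega> (i, k))) UNIV"
      using ind unfolding eq .
  next
    fix k
    show "(\<integral>\<omega>. f (\<lambda>i. \<omega> (i, k)) \<partial>grid) = 0"
      using int[of "\<lambda>x. x" k] integral_feature_sum[of n c] by (simp add: f_def P_def)
    show "(\<integral>\<omega>. (f (\<lambda>i. \<omega> (i, k)))\<^sup>2 \<partial>grid) = (\<Sum>a\<in>index_sets n. (c a)\<^sup>2 * feature_var a)"
      using int[of "\<lambda>x. x\<^sup>2" k] integral_feature_sum_sq[of n c] by (simp add: f_def P_def)
    have "integrable (distr grid P (\<lambda>\<omega>. \<lambda>i\<in>{1..n}. \<omega> (i, k))) (\<lambda>x. (f x)\<^sup>2)"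
      unfolding P unfolding f_def P_def by (rule integrable_feature_sum_sq)
    then show "integrable grid (\<lambda>\<omega>. (f (\<lambda>i. \<omega> (i, k)))\<^sup>2)"
      by (subst (asm) integrable_distr_eq) (simp_all add: col del: One_nat_def)
    have "distr grid borel (\<lambda>\<omega>. f (\<lambda>i. \<omega> (i, k))) = distr (distr grid P (\<lambda>\<omega>. \<lambda>i\<in>{1..n}. \<omega> (i, k))) borel f"
      by (subst distr_distr) (simp_all add: col comp_def del: One_nat_def)
    then show "distr grid borel (\<lambda>\<omega>. f (\<lambda>i. \<omega> (i, k))) = distr P borel f"
      unfolding P .
  qed
qed

section \<open>Squared distances as linear forms in the features\<close>

text \<open>Coefficients of \<open>(x i - x j)\<^sup>2 - 2 * var\<close> in the features for
  \<open>e = {i, j}\<close>. Addressing them by vertex sets avoids choosing an order of the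
  endpoints.\<close>

definition edge_coeff :: "nat set \<Rightarrow> nat set \<Rightarrow> real" where
  "edge_coeff e a = (if a = e then - 2 else if card a = 1 \<and> a \<subseteq> e then 1 else 0)"

lemma sum_edge_coeff:
  fixes v :: "nat set \<Rightarrow> real"
  assumes "i \<in> {1..n}" "j \<in> {1..n}" "i \<noteq> j"
  shows "(\<Sum>a\<in>index_sets n. edge_coeff {i, j} a * v a) = v {i} + v {j} - 2 * v {i, j}"
proof -
  have "(\<Sum>a\<in>index_sets n. edge_coeff {i, j} a * v a) = (\<Sum>a\<in>{{i}, {j}, {i, j}}. edge_coeff {i, j} a * v a)"
    using assms
    by (intro sum.mono_neutral_right finite_index_sets)
      (auto simp: index_sets_def edge_coeff_def card_1_singleton_iff)
  also have "\<dots> = v {i} + v {j} - 2 * v {i, j}"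
    using assms by (simp add: edge_coeff_def doubleton_eq_iff)
  finally show ?thesis .
qed

lemma feature_edge:
  assumes "i \<in> {1..n}" "j \<in> {1..n}" "i \<noteq> j"
  shows "(\<Sum>a\<in>index_sets n. edge_coeff {i, j} a * feature a x) = (x i - x j)\<^sup>2 - 2 * var"
  unfolding sum_edge_coeff[OF assms] using assms
  by (simp add: feature_def factor_def power2_eq_square algebra_simps)

text \<open>For fixed \<open>x\<close> the mixed term of \<open>(x - y)\<^sup>2\<close>, expanded
  around the mean, integrates to 0. This identifies the centring in the normalised connection range
  with the constant split off in \<open>feature_edge\<close>.\<close>

lemma mean_sq_dist_eq: "mean_sq_dist \<pi> = 2 * var"
proof -
  interpret P: pair_prob_space \<pi> \<pi> ..
  have id: "(\<lambda>x. x) \<in> borel_measurable \<pi>" by (rule borel_measurable_coordinate) simp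
  have m: "(\<lambda>z. (fst z - snd z)\<^sup>2) \<in> borel_measurable (\<pi> \<Otimes>\<^sub>M \<pi>)"
    by (intro borel_measurable_power borel_measurable_diff measurable_compose[OF measurable_fst id] measurable_compose[OF measurable_snd id])
  have "integrable (\<pi> \<Otimes>\<^sub>M \<pi>) (\<lambda>z. (fst z - snd z)\<^sup>2)"
  proof (rule P.integrable_const_bound[OF _ m, where B=1])
    show "AE z in \<pi> \<Otimes>\<^sub>M \<pi>. norm ((fst z - snd z)\<^sup>2) \<le> 1"
    proof (rule AE_I2)
      fix z assume "z \<in> space (\<pi> \<Otimes>\<^sub>M \<pi>)"
      then have "\<bar>fst z - snd z\<bar> \<le> 1" by (auto simp: space_pair_measure space_coordinate)
      then show "norm ((fst z - snd z)\<^sup>2) \<le> 1" by (simp add: abs_square_le_1)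
    qed
  qed
  then have "(\<integral>z. (fst z - snd z)\<^sup>2 \<partial>(\<pi> \<Otimes>\<^sub>M \<pi>)) = (\<integral>x. (\<integral>y. (x - y)\<^sup>2 \<partial>\<pi>) \<partial>\<pi>)"
    by (subst P.integral_fst'[symmetric]) simp_all
  also have "\<dots> = (\<integral>x. (x - mean)\<^sup>2 + var \<partial>\<pi>)"
  proof (intro Bochner_Integration.integral_cong refl)
    fix x
    have eq: "(\<lambda>y. (x - y)\<^sup>2) = (\<lambda>y. (x - mean)\<^sup>2 + (y - mean)\<^sup>2 - 2 * (x - mean) * (y - mean))"
      by (simp add: fun_eq_iff power2_eq_square algebra_simps)
    have i: "integrable \<pi> (\<lambda>y. (y - mean)\<^sup>2)" "integrable \<pi> (\<lambda>y. y)" by (intro integrable_continuous continuous_intros)+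
    show "(\<integral>y. (x - y)\<^sup>2 \<partial>\<pi>) = (x - mean)\<^sup>2 + var"
      using i by (subst eq, simp add: prob_space) (simp add: central_moment_def)
  qed
  also have "\<dots> = 2 * var"
  proof -
    have i: "integrable \<pi> (\<lambda>y. (y - mean)\<^sup>2)" by (intro integrable_continuous continuous_intros)
    show ?thesis using i by (simp add: prob_space) (simp add: central_moment_def)
  qed
  finally show ?thesis by (simp add: mean_sq_dist_def case_prod_unfold)
qed

section \<open>Transfer of the graph law to the grid\<close>

lemma measurable_euclidean_dist:
  "(\<lambda>(x, y). euclidean_dist d x y) \<in> borel_measurable (coordinate_product d \<pi> \<Otimes>\<^sub>M coordinate_product d \<pi>)"
  unfolding euclidean_dist_def L2_set_def case_prod_beta coordinate_product_def
  by (intro measurable_compose[OF _ borel_measurable_continuous_onI[OF continuous_on_real_sqrt[OF continuous_on_id]]]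
      borel_measurable_sum borel_measurable_power borel_measurable_diff
      measurable_compose[OF measurable_fst borel_measurable_component]
      measurable_compose[OF measurable_snd borel_measurable_component]) auto

text \<open>Rows of the grid are disjoint, hence independent, and each has the law of a random
  point. This moves the ensembles of all dimensions to one fixed sample space, as the convergence
  result requires.\<close>

lemma distr_grid_points:
  assumes "n \<ge> 1"
  shows "distr grid (\<Pi>\<^sub>M i\<in>{1..n}. coordinate_product d \<pi>) (\<lambda>\<omega>. \<lambda>i\<in>{1..n}. \<lambda>k\<in>{..<d}. \<omega> (i, k))
    = (\<Pi>\<^sub>M i\<in>{1..n}. coordinate_product d \<pi>)"
proof -
  interpret G: prob_space grid by (rule prob_space_grid)
  have m: "(\<lambda>z. \<lambda>k\<in>{..<d}. z (i, k)) \<in> measurable (PiM ({i} \<times> {..<d}) (\<lambda>_. \<pi>)) (coordinate_product d \<pi>)" for i :: nat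
    unfolding coordinate_product_def by (intro measurable_restrict measurable_component_singleton) auto
  have "G.indep_vars (\<lambda>i. PiM ({i} \<times> {..<d}) (\<lambda>_. \<pi>)) (\<lambda>i \<omega>. restrict (\<lambda>p. \<omega> p) ({i} \<times> {..<d})) {1..n}"
    by (intro G.indep_vars_restrict[OF indep_vars_grid]) (auto simp: disjoint_family_on_def)
  then have ind: "G.indep_vars (\<lambda>i. coordinate_product d \<pi>)
      (\<lambda>i \<omega>. \<lambda>k\<in>{..<d}. restrict (\<lambda>p. \<omega> p) ({i} \<times> {..<d}) (i, k)) {1..n}"
    by (rule G.indep_vars_compose2) (rule m)
  have eq: "(\<lambda>i \<omega>. \<lambda>k\<in>{..<d}. restrict (\<lambda>p. \<omega> p) ({i} \<times> {..<d}) (i, k))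
      = (\<lambda>i \<omega>. \<lambda>k\<in>{..<d}. (\<omega> :: nat \<times> nat \<Rightarrow> real) (i, k))"
    by (auto simp: fun_eq_iff)
  have "G.indep_vars (\<lambda>i. coordinate_product d \<pi>) (\<lambda>i \<omega>. \<lambda>k\<in>{..<d}. \<omega> (i, k)) {1..n}"
    using ind unfolding eq .
  moreover have "(\<lambda>\<omega>. \<lambda>k\<in>{..<d}. \<omega> (i, k)) \<in> measurable grid (coordinate_product d \<pi>)" for i
    unfolding coordinate_product_def grid_def by (intro measurable_restrict measurable_component_singleton) auto
  moreover have "{1..n} \<noteq> {}" using assms by simp
  ultimately have "distr grid (\<Pi>\<^sub>M i\<in>{1..n}. coordinate_product d \<pi>) (\<lambda>\<omega>. \<lambda>i\<in>{1..n}. \<lambda>k\<in>{..<d}. \<omega> (i, k))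
     = (\<Pi>\<^sub>M i\<in>{1..n}. distr grid (coordinate_product d \<pi>) (\<lambda>\<omega>. \<lambda>k\<in>{..<d}. \<omega> (i, k)))"
    by (subst (asm) G.indep_vars_iff_distr_eq_PiM'[OF \<open>{1..n} \<noteq> {}\<close>]) auto
  moreover have "distr grid (coordinate_product d \<pi>) (\<lambda>\<omega>. \<lambda>k\<in>{..<d}. \<omega> (i, k)) = coordinate_product d \<pi>" for i
    unfolding coordinate_product_def by (rule distr_grid_reindex) (auto simp: inj_on_def)
  ultimately show ?thesis by simp
qed

text \<open>For \<open>d \<ge> 1\<close> and an edge \<open>e\<close> this is the squared distance
  minus \<open>r\<^sup>2\<close>, divided by \<open>sqrt d\<close>. The moving threshold is
  subtracted so that every \<open>d\<close> uses the same half-lines ending at 0.\<close>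

definition edge_score :: "nat \<Rightarrow> nat \<Rightarrow> real \<Rightarrow> nat set \<Rightarrow> (nat \<times> nat \<Rightarrow> real) \<Rightarrow> real" where
  "edge_score n d r e \<omega> =
     (\<Sum>k<d. \<Sum>a\<in>index_sets n. edge_coeff e a * feature a (\<lambda>i. \<omega> (i, k))) / sqrt (real d)
       - (r\<^sup>2 / sqrt (real d) - mean_sq_dist \<pi> * sqrt (real d))"

lemma borel_measurable_edge_score: "edge_score n d r e \<in> borel_measurable grid"
  unfolding edge_score_def feature_def grid_def
  by (intro borel_measurable_sum borel_measurable_times borel_measurable_const borel_measurable_prod borel_measurable_diff
        borel_measurable_divide
        measurable_compose[OF borel_measurable_component borel_measurable_continuous_onI[OF continuous_factor]])
     auto

lemma edge_score_le_0_iff: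
  assumes "i \<in> {1..n}" "j \<in> {1..n}" "i \<noteq> j" "d \<ge> 1" "r \<ge> 0"
  shows "edge_score n d r {i, j} \<omega> \<le> 0 \<longleftrightarrow> euclidean_dist d (\<lambda>k. \<omega> (i, k)) (\<lambda>k. \<omega> (j, k)) \<le> r"
proof -
  let ?S = "\<Sum>k<d. (\<omega> (i, k) - \<omega> (j, k))\<^sup>2"
  have S: "?S \<ge> 0" by (intro sum_nonneg) auto
  have d: "sqrt (real d) > 0" using assms by simp
  \<comment> \<open>The \<open>d\<close> centring terms \<open>2 * var\<close>, divided by
    \<open>sqrt d\<close>, cancel against \<open>mean_sq_dist \<pi> * sqrt d\<close>.\<close>
  have "edge_score n d r {i, j} \<omega> = (?S - r\<^sup>2) / sqrt (real d)"
    unfolding edge_score_def feature_edge[OF assms(1-3)] mean_sq_dist_eq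
    using real_div_sqrt[of "real d"] by (simp add: sum_subtractf diff_divide_distrib mult.commute[of _ "real d"] flip: times_divide_eq_left)
  then have "edge_score n d r {i, j} \<omega> \<le> 0 \<longleftrightarrow> ?S \<le> r\<^sup>2"
    using d by (simp add: divide_le_0_iff)
  also have "\<dots> \<longleftrightarrow> sqrt ?S \<le> r"
    using S assms by (simp add: real_sqrt_le_iff' sqrt_le_D real_le_lsqrt)
  finally show ?thesis by (simp add: euclidean_dist_def L2_set_def)
qed

text \<open>The graph is determined by the sign condition at each vertex pair, so the event is a
  rectangle in the scores with half-lines as sides, the shape to which
  \<open>prob_tendsto_of_iexp_tendsto\<close> applies.\<close>

lemma measure_cube_rgg:
  assumes "n \<ge> 1" "d \<ge> 1" "r \<ge> 0" and g: "g \<subseteq> vertex_pairs n"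
  shows "measure (cube_rgg d \<pi> n r) {g} =
    measure grid {\<omega> \<in> space grid. \<forall>e\<in>vertex_pairs n. edge_score n d r e \<omega> \<in> (if e \<in> g then {..0} else {0<..})}"
proof -
  let ?P = "\<Pi>\<^sub>M i\<in>{1..n}. coordinate_product d \<pi>"
  let ?G = "geometric_graph (euclidean_dist d) n r"
  let ?X = "\<lambda>\<omega>. \<lambda>i\<in>{1..n}. \<lambda>k\<in>{..<d}. \<omega> (i, k)"
  have G: "?G \<in> measurable ?P (count_space (Pow (vertex_pairs n)))"
    by (rule measurable_geometric_graph[OF measurable_euclidean_dist])
  have X: "?X \<in> measurable grid ?P"
    unfolding coordinate_product_def grid_def by (intro measurable_restrict measurable_component_singleton) auto
  have iff: "?G (?X \<omega>) = g \<longleftrightarrow> (\<forall>e\<in>vertex_pairs n. edge_score n d r e \<omega> \<in> (if e \<in> g then {..0} else {0<..}))" for \<omega>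
  proof -
    have sym: "euclidean_dist d x y = euclidean_dist d y x" for x y
      by (simp add: euclidean_dist_def L2_set_def power2_commute)
    have mem: "e \<in> ?G (?X \<omega>) \<longleftrightarrow> edge_score n d r e \<omega> \<le> 0" if "e \<in> vertex_pairs n" for e
    proof -
      have e2: "e \<subseteq> {1..n}" "card e = 2" using that by (simp_all add: vertex_pairs_def)
      then obtain i j where ij: "e = {i, j}" "i \<noteq> j" by (auto simp: card_2_iff)
      then have e: "e = {i, j}" "i \<noteq> j" "i \<in> {1..n}" "j \<in> {1..n}" using e2(1) by simp_all
      have "e \<in> ?G (?X \<omega>) \<longleftrightarrow> euclidean_dist d (?X \<omega> i) (?X \<omega> j) \<le> r"
      proof
        assume "e \<in> ?G (?X \<omega>)"
        then obtain i' j' where ij: "{i, j} = {i', j'}" and le: "euclidean_dist d (?X \<omega> i') (?X \<omega> j') \<le> r"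
          unfolding geometric_graph_def e(1) by blast
        from ij consider "i' = i" "j' = j" | "i' = j" "j' = i"
          unfolding doubleton_eq_iff by blast
        then show "euclidean_dist d (?X \<omega> i) (?X \<omega> j) \<le> r"
          by cases (use le sym in \<open>simp_all only:\<close>)
      next
        assume "euclidean_dist d (?X \<omega> i) (?X \<omega> j) \<le> r"
        then show "e \<in> ?G (?X \<omega>)" unfolding geometric_graph_def e(1) using e(2-) by blast
      qed
      also have "euclidean_dist d (?X \<omega> i) (?X \<omega> j) = euclidean_dist d (\<lambda>k. \<omega> (i, k)) (\<lambda>k. \<omega> (j, k))"
        using e(3,4) unfolding euclidean_dist_def by (intro L2_set_cong) simp_all
      finally show ?thesis
        unfolding e(1) edge_score_le_0_iff[OF e(3,4,2) assms(2,3)] .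
    qed
    have "?G (?X \<omega>) = g \<longleftrightarrow> (\<forall>e\<in>vertex_pairs n. e \<in> ?G (?X \<omega>) \<longleftrightarrow> e \<in> g)"
      using geometric_graph_subset[of "euclidean_dist d" n r "?X \<omega>"] g by blast
    also have "\<dots> \<longleftrightarrow> (\<forall>e\<in>vertex_pairs n. edge_score n d r e \<omega> \<in> (if e \<in> g then {..0} else {0<..}))"
    proof (intro ball_cong refl)
      fix e assume e: "e \<in> vertex_pairs n"
      show "(e \<in> ?G (?X \<omega>) \<longleftrightarrow> e \<in> g) \<longleftrightarrow> edge_score n d r e \<omega> \<in> (if e \<in> g then {..0} else {0<..})"
        unfolding mem[OF e] by (simp add: not_le)
    qed
    finally show ?thesis .
  qed
  have "cube_rgg d \<pi> n r = distr (distr grid ?P ?X) (count_space (Pow (vertex_pairs n))) ?G"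
    unfolding cube_rgg_def hard_rgg_def distr_grid_points[OF assms(1)] ..
  also have "\<dots> = distr grid (count_space (Pow (vertex_pairs n))) (?G \<circ> ?X)"
    by (rule distr_distr[OF G X])
  finally have cube: "cube_rgg d \<pi> n r = distr grid (count_space (Pow (vertex_pairs n))) (?G \<circ> ?X)" .
  have "measure (cube_rgg d \<pi> n r) {g} = measure grid ((?G \<circ> ?X) -` {g} \<inter> space grid)"
    unfolding cube using g by (intro measure_distr[OF measurable_comp[OF X G]]) simp
  also have "(?G \<circ> ?X) -` {g} \<inter> space grid = {\<omega> \<in> space grid. ?G (?X \<omega>) = g}"
    unfolding comp_def vimage_def by blast
  also have "\<dots> = {\<omega> \<in> space grid. \<forall>e\<in>vertex_pairs n. edge_score n d r e \<omega> \<in> (if e \<in> g then {..0} else {0<..})}"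
    unfolding iff ..
  finally show ?thesis .
qed

text \<open>A linear combination of edge scores is again a feature sum, after exchanging the sums
  over edges and features. The threshold is deterministic and contributes only a convergent phase
  factor.\<close>

lemma iexp_edge_score_tendsto:
  assumes t: "(\<lambda>d. (r d)\<^sup>2 / sqrt (real d) - mean_sq_dist \<pi> * sqrt (real d)) \<longlonglongrightarrow> t"
  shows "(\<lambda>d. \<integral>\<omega>. iexp (\<Sum>e\<in>vertex_pairs n. \<theta> e * edge_score n d (r d) e \<omega>) \<partial>grid) \<longlonglongrightarrow>
    complex_of_real (exp (- (\<Sum>a\<in>index_sets n. (\<Sum>e\<in>vertex_pairs n. \<theta> e * edge_coeff e a)\<^sup>2 * feature_var a) / 2))
      * iexp (- t * (\<Sum>e\<in>vertex_pairs n. \<theta> e))"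
proof -
  let ?t = "\<lambda>d. (r d)\<^sup>2 / sqrt (real d) - mean_sq_dist \<pi> * sqrt (real d)"
  let ?c = "\<lambda>a. \<Sum>e\<in>vertex_pairs n. \<theta> e * edge_coeff e a"
  let ?S = "\<lambda>d \<omega>. (\<Sum>k<d. \<Sum>a\<in>index_sets n. ?c a * feature a (\<lambda>i. \<omega> (i, k))) / sqrt (real d)"
  have eq: "(\<Sum>e\<in>vertex_pairs n. \<theta> e * edge_score n d (r d) e \<omega>) = ?S d \<omega> + - ?t d * (\<Sum>e\<in>vertex_pairs n. \<theta> e)" for d \<omega>
  proof -
    let ?s = "\<lambda>e. \<Sum>k<d. \<Sum>a\<in>index_sets n. edge_coeff e a * feature a (\<lambda>i. \<omega> (i, k))"
    have "(\<Sum>e\<in>vertex_pairs n. \<theta> e * ?s e) = (\<Sum>e\<in>vertex_pairs n. \<Sum>k<d. \<Sum>a\<in>index_sets n. \<theta> e * edge_coeff e a * feature a (\<lambda>i. \<omega> (i, k)))"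
      by (simp add: sum_distrib_left mult.assoc)
    also have "\<dots> = (\<Sum>k<d. \<Sum>e\<in>vertex_pairs n. \<Sum>a\<in>index_sets n. \<theta> e * edge_coeff e a * feature a (\<lambda>i. \<omega> (i, k)))"
      by (rule sum.swap)
    also have "\<dots> = (\<Sum>k<d. \<Sum>a\<in>index_sets n. \<Sum>e\<in>vertex_pairs n. \<theta> e * edge_coeff e a * feature a (\<lambda>i. \<omega> (i, k)))"
      by (intro sum.cong refl sum.swap)
    also have "\<dots> = (\<Sum>k<d. \<Sum>a\<in>index_sets n. ?c a * feature a (\<lambda>i. \<omega> (i, k)))"
      by (simp add: sum_distrib_right)
    finally have s: "(\<Sum>e\<in>vertex_pairs n. \<theta> e * ?s e) = (\<Sum>k<d. \<Sum>a\<in>index_sets n. ?c a * feature a (\<lambda>i. \<omega> (i, k)))" .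
    have "(\<Sum>e\<in>vertex_pairs n. \<theta> e * edge_score n d (r d) e \<omega>) =
        (\<Sum>e\<in>vertex_pairs n. \<theta> e * ?s e / sqrt (real d) - ?t d * \<theta> e)"
      unfolding edge_score_def by (intro sum.cong refl) (simp add: algebra_simps)
    also have "\<dots> = (\<Sum>e\<in>vertex_pairs n. \<theta> e * ?s e) / sqrt (real d) - ?t d * (\<Sum>e\<in>vertex_pairs n. \<theta> e)"
      by (simp only: sum_subtractf sum_divide_distrib sum_distrib_left)
    finally show ?thesis by (simp only: s mult_minus_left diff_conv_add_uminus)
  qed
  have split: "(\<integral>\<omega>. iexp (\<Sum>e\<in>vertex_pairs n. \<theta> e * edge_score n d (r d) e \<omega>) \<partial>grid) =
      (\<integral>\<omega>. iexp (?S d \<omega>) \<partial>grid) * iexp (- ?t d * (\<Sum>e\<in>vertex_pairs n. \<theta> e))" for d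
    unfolding eq of_real_add distrib_left exp_add integral_mult_left_zero ..
  show ?thesis
    unfolding split
    by (intro tendsto_mult iexp_feature_sum_tendsto tendsto_exp tendsto_of_real tendsto_minus tendsto_const t)
qed

end

section \<open>The Gaussian limit\<close>

abbreviation gauss :: "'i set \<Rightarrow> ('i \<Rightarrow> real) measure" where
  "gauss I \<equiv> PiM I (\<lambda>_. std_normal_distribution)"

lemma prob_space_std_normal: "prob_space std_normal_distribution"
  using real_dist_normal_dist by (simp add: real_distribution_def)

lemma prob_space_gauss: "prob_space (gauss I)"
  by (rule prob_space_PiM) (rule prob_space_std_normal)

lemma borel_measurable_gauss [measurable]: "(\<lambda>z. z a) \<in> borel_measurable (gauss I)" if "a \<in> I"
proof -
  have "(\<lambda>z. z a) \<in> measurable (gauss I) std_normal_distribution"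
    using that by (rule measurable_component_singleton)
  then show ?thesis by simp
qed

lemma borel_measurable_gauss_sum:
  "J \<subseteq> I \<Longrightarrow> (\<lambda>z. \<Sum>a\<in>J. c a * z a) \<in> borel_measurable (gauss I)"
  by (intro borel_measurable_sum borel_measurable_times borel_measurable_const borel_measurable_gauss) auto

lemma integral_iexp_gauss:
  assumes I: "finite I"
  shows "(\<integral>z. iexp (\<Sum>a\<in>I. c a * z a) \<partial>gauss I) = complex_of_real (exp (- (\<Sum>a\<in>I. (c a)\<^sup>2) / 2))"
proof -
  interpret std: prob_space std_normal_distribution by (rule prob_space_std_normal)
  interpret product_prob_space "\<lambda>_. std_normal_distribution" I by unfold_locales
  have int: "integrable std_normal_distribution (\<lambda>x. iexp (c a * x))" for a
    by (rule std.integrable_const_bound[where B=1]) auto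
  have "(\<integral>z. iexp (\<Sum>a\<in>I. c a * z a) \<partial>gauss I) = (\<integral>z. (\<Prod>a\<in>I. iexp (c a * z a)) \<partial>gauss I)"
    using I by (simp add: exp_sum sum_distrib_left)
  also have "\<dots> = (\<Prod>a\<in>I. char std_normal_distribution (c a))"
    unfolding char_def by (rule product_integral_prod[OF I int])
  also have "\<dots> = complex_of_real (exp (- (\<Sum>a\<in>I. (c a)\<^sup>2) / 2))"
  proof -
    have "- (\<Sum>a\<in>I. (c a)\<^sup>2) / 2 = (\<Sum>a\<in>I. - ((c a)\<^sup>2 / 2))"
      by (simp add: sum_negf sum_divide_distrib)
    then show ?thesis using I
      by (simp only: exp_sum) (simp add: char_std_normal_distribution)
  qed
  finally show ?thesis .
qed

text \<open>Both sides have the same characteristic function. The point is that the law depends only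
  on the sum of squared coefficients: this excludes atoms and identifies the laws of two different
  sums.\<close>

lemma distr_gauss_sum:
  assumes I: "finite I"
  shows "distr (gauss I) borel (\<lambda>z. \<Sum>a\<in>I. c a * z a) =
    distr std_normal_distribution borel (\<lambda>x. sqrt (\<Sum>a\<in>I. (c a)\<^sup>2) * x)"
proof (rule Levy_uniqueness)
  interpret G: prob_space "gauss I" by (rule prob_space_gauss)
  interpret std: prob_space std_normal_distribution by (rule prob_space_std_normal)
  note m = borel_measurable_gauss_sum[OF subset_refl]
  show "real_distribution (distr (gauss I) borel (\<lambda>z. \<Sum>a\<in>I. c a * z a))"
    by (rule G.real_distribution_distr[OF m])
  show "real_distribution (distr std_normal_distribution borel (\<lambda>x. sqrt (\<Sum>a\<in>I. (c a)\<^sup>2) * x))"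
    by (rule std.real_distribution_distr) simp
  show "char (distr (gauss I) borel (\<lambda>z. \<Sum>a\<in>I. c a * z a)) =
    char (distr std_normal_distribution borel (\<lambda>x. sqrt (\<Sum>a\<in>I. (c a)\<^sup>2) * x))"
  proof
    fix t
    have "char (distr (gauss I) borel (\<lambda>z. \<Sum>a\<in>I. c a * z a)) t = (\<integral>z. iexp (\<Sum>a\<in>I. (t * c a) * z a) \<partial>gauss I)"
      unfolding char_def using m by (subst integral_distr) (simp_all add: sum_distrib_left mult.assoc)
    also have "\<dots> = complex_of_real (exp (- (t\<^sup>2 * (\<Sum>a\<in>I. (c a)\<^sup>2)) / 2))"
      unfolding integral_iexp_gauss[OF I] by (simp add: power_mult_distrib sum_distrib_left)
    also have "\<dots> = char std_normal_distribution (t * sqrt (\<Sum>a\<in>I. (c a)\<^sup>2))"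
      by (simp add: char_std_normal_distribution power_mult_distrib sum_nonneg)
    also have "\<dots> = char (distr std_normal_distribution borel (\<lambda>x. sqrt (\<Sum>a\<in>I. (c a)\<^sup>2) * x)) t"
      unfolding char_def by (subst integral_distr) (simp_all add: mult.assoc)
    finally show "char (distr (gauss I) borel (\<lambda>z. \<Sum>a\<in>I. c a * z a)) t =
      char (distr std_normal_distribution borel (\<lambda>x. sqrt (\<Sum>a\<in>I. (c a)\<^sup>2) * x)) t" .
  qed
qed

lemma gauss_sum_no_atom:
  assumes I: "finite I" and pos: "(\<Sum>a\<in>I. (c a)\<^sup>2) > 0"
  shows "measure (gauss I) {z \<in> space (gauss I). (\<Sum>a\<in>I. c a * z a) = t} = 0"
proof -
  let ?v = "sqrt (\<Sum>a\<in>I. (c a)\<^sup>2)"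
  have "measure (gauss I) {z \<in> space (gauss I). (\<Sum>a\<in>I. c a * z a) = t} =
    measure (distr (gauss I) borel (\<lambda>z. \<Sum>a\<in>I. c a * z a)) {t}"
    using borel_measurable_gauss_sum[OF subset_refl, of c I]
    by (subst measure_distr) (auto intro!: arg_cong[where f="measure (gauss I)"])
  also have "\<dots> = measure std_normal_distribution ((\<lambda>x. ?v * x) -` {t} \<inter> UNIV)"
    unfolding distr_gauss_sum[OF I] by (subst measure_distr) auto
  also have "(\<lambda>x. ?v * x) -` {t} \<inter> UNIV = {t / ?v}"
    using pos by (auto simp: field_simps)
  also have "measure std_normal_distribution {t / ?v} = 0"
  proof -
    have "AE x in lborel. x \<noteq> t / ?v" by (rule AE_lborel_singleton)
    then have "emeasure std_normal_distribution {t / ?v} = 0"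
      by (subst emeasure_density) (auto simp: nn_integral_0_iff_AE indicator_def elim!: eventually_mono)
    then show ?thesis by (simp add: measure_def)
  qed
  finally show ?thesis .
qed

section \<open>Two Gaussian events with a shared coordinate\<close>

lemma indep_gauss_sums:
  assumes "J \<inter> L = {}" "J \<union> L \<subseteq> I" "I \<noteq> {}"
  shows "prob_space.indep_var (gauss I) borel (\<lambda>z. \<Sum>a\<in>J. c a * z a) borel (\<lambda>z. \<Sum>a\<in>L. c' a * z a)"
proof -
  interpret G: prob_space "gauss I" by (rule prob_space_gauss)
  have ind: "G.indep_vars (\<lambda>_. std_normal_distribution) (\<lambda>i z. z i) I"
    using assms by (intro indep_vars_PiM_coordinates prob_space_std_normal)
  have "G.indep_var (gauss J) (\<lambda>z. restrict (\<lambda>i. z i) J) (gauss L) (\<lambda>z. restrict (\<lambda>i. z i) L)"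
    using assms by (intro G.indep_var_restrict[OF ind]) auto
  then have "G.indep_var borel ((\<lambda>z. \<Sum>a\<in>J. c a * z a) \<circ> (\<lambda>z. restrict (\<lambda>i. z i) J))
      borel ((\<lambda>z. \<Sum>a\<in>L. c' a * z a) \<circ> (\<lambda>z. restrict (\<lambda>i. z i) L))"
    by (rule G.indep_var_compose) (rule borel_measurable_gauss_sum[OF subset_refl])+
  then show ?thesis by (simp add: comp_def cong: sum.cong)
qed

lemma sets_std_normal: "sets std_normal_distribution = sets borel"
  by simp

text \<open>Fubini with coordinate \<open>i\<close> in the outer integral. The predicate receives
  the value at \<open>i\<close> as a separate argument, and the invariance assumption says that it
  reads this coordinate in no other way.\<close>

lemma measure_gauss_insert:
  assumes K: "finite K" "i \<notin> K"
    and A: "{z \<in> space (gauss (insert i K)). P (z i) z} \<in> sets (gauss (insert i K))"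
    and B: "\<And>y. {z \<in> space (gauss K). P y z} \<in> sets (gauss K)"
    and P: "\<And>y z. P y (z(i := y)) = P y z"
    and meas: "(\<lambda>y. measure (gauss K) {z \<in> space (gauss K). P y z}) \<in> borel_measurable borel"
  shows "measure (gauss (insert i K)) {z \<in> space (gauss (insert i K)). P (z i) z} =
      (\<integral>y. measure (gauss K) {z \<in> space (gauss K). P y z} \<partial>std_normal_distribution)"
proof -
  interpret std: prob_space std_normal_distribution by (rule prob_space_std_normal)
  interpret K: prob_space "gauss K" by (rule prob_space_gauss)
  interpret G: prob_space "gauss (insert i K)" by (rule prob_space_gauss)
  interpret S: product_prob_space "\<lambda>_. std_normal_distribution" "insert i K" by unfold_locales
  let ?A = "{z \<in> space (gauss (insert i K)). P (z i) z}"
  have int: "integrable std_normal_distribution (\<lambda>y. measure (gauss K) {z \<in> space (gauss K). P y z})"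
  proof (rule std.integrable_const_bound[where B=1])
    show "(\<lambda>y. measure (gauss K) {z \<in> space (gauss K). P y z}) \<in> borel_measurable std_normal_distribution"
      using meas unfolding measurable_cong_sets[OF sets_std_normal refl] .
    show "AE y in std_normal_distribution. norm (measure (gauss K) {z \<in> space (gauss K). P y z}) \<le> 1"
      by (rule AE_I2) (simp add: K.prob_le_1)
  qed
  have "emeasure (gauss (insert i K)) ?A = (\<integral>\<^sup>+z. indicator ?A z \<partial>gauss (insert i K))"
    by (rule nn_integral_indicator[OF A, symmetric])
  also have "\<dots> = (\<integral>\<^sup>+y. (\<integral>\<^sup>+x. indicator ?A (x(i := y)) \<partial>gauss K) \<partial>std_normal_distribution)"
    by (rule S.product_nn_integral_insert_rev[OF K borel_measurable_indicator[OF A]])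
  also have "\<dots> = (\<integral>\<^sup>+y. ennreal (measure (gauss K) {z \<in> space (gauss K). P y z}) \<partial>std_normal_distribution)"
  proof (intro nn_integral_cong)
    fix y
    have "(\<integral>\<^sup>+x. indicator ?A (x(i := y)) \<partial>gauss K) = (\<integral>\<^sup>+x. indicator {z \<in> space (gauss K). P y z} x \<partial>gauss K)"
    proof (intro nn_integral_cong)
      fix x assume x: "x \<in> space (gauss K)"
      then have "x(i := y) \<in> space (gauss (insert i K))"
        unfolding space_PiM by (intro PiE_fun_upd) simp_all
      then show "indicator ?A (x(i := y)) = (indicator {z \<in> space (gauss K). P y z} x :: ennreal)"
        using x by (simp add: indicator_def P)
    qed
    also have "\<dots> = emeasure (gauss K) {z \<in> space (gauss K). P y z}"
      by (rule nn_integral_indicator[OF B])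
    finally show "(\<integral>\<^sup>+x. indicator ?A (x(i := y)) \<partial>gauss K) = ennreal (measure (gauss K) {z \<in> space (gauss K). P y z})"
      by (simp only: K.emeasure_eq_measure)
  qed
  also have "\<dots> = ennreal (\<integral>y. measure (gauss K) {z \<in> space (gauss K). P y z} \<partial>std_normal_distribution)"
    by (rule nn_integral_eq_integral[OF int]) simp
  finally show ?thesis
    by (simp only: G.emeasure_eq_measure) (simp add: integral_nonneg_AE)
qed

text \<open>Conditionally on the shared coordinate, both events are independent with the same
  probability \<open>h\<close>; were the events independent fair coins, \<open>h\<close> would have variance \<open>0\<close>.\<close>

lemma correlated_gauss_not_fair_coins:
  fixes c c' :: "'i \<Rightarrow> real"
  assumes fin: "finite J" "finite L" "J \<noteq> {}" and disj: "J \<inter> L = {}" "i \<notin> J \<union> L" and \<tau>: "\<tau> > 0"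
    and I: "I = insert i (J \<union> L)"
    and same: "(\<Sum>a\<in>J. (c a)\<^sup>2) = (\<Sum>a\<in>L. (c' a)\<^sup>2)"
    and half: "measure (gauss I) {z \<in> space (gauss I). \<tau> * z i + (\<Sum>a\<in>J. c a * z a) \<le> t} = 1 / 2"
      and quarter: "measure (gauss I) {z \<in> space (gauss I).
        \<tau> * z i + (\<Sum>a\<in>J. c a * z a) \<le> t \<and> \<tau> * z i + (\<Sum>a\<in>L. c' a * z a) \<le> t} = 1 / 4"
  shows False
proof -
  interpret std: prob_space std_normal_distribution by (rule prob_space_std_normal)
  define K where "K = J \<union> L"
  interpret K: prob_space "gauss K" by (rule prob_space_gauss)
  interpret G: prob_space "gauss I" by (rule prob_space_gauss)
  have K: "finite K" "i \<notin> K" "I = insert i K" using assms by (auto simp: K_def)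
  let ?R = "\<lambda>z. \<Sum>a\<in>J. c a * z a" and ?R' = "\<lambda>z. \<Sum>a\<in>L. c' a * z a"
  have RK: "?R \<in> borel_measurable (gauss K)" "?R' \<in> borel_measurable (gauss K)"
    by (intro borel_measurable_gauss_sum; auto simp: K_def)+
  \<comment> \<open>The law of the unshared part. By \<open>same\<close> it is also the law of the
    second sum, so given the shared value \<open>y\<close> both events have probability
    \<open>h y\<close>.\<close>
  define \<rho> where "\<rho> = distr (gauss K) borel ?R"
  interpret \<rho>: real_distribution \<rho> unfolding \<rho>_def by (rule K.real_distribution_distr) (rule RK(1))
  define h where "h y = cdf \<rho> (t - \<tau> * y)" for y
  have cdf_meas: "cdf \<rho> \<in> borel_measurable borel"
    by (intro borel_measurable_mono monoI \<rho>.cdf_nondecreasing)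
  have h_meas: "h \<in> borel_measurable borel"
    unfolding h_def[abs_def] by (rule measurable_compose[OF _ cdf_meas]) simp
  have distr_sum: "distr (gauss K) borel (\<lambda>z. \<Sum>a\<in>S. d a * z a) =
      distr std_normal_distribution borel (\<lambda>x. sqrt (\<Sum>a\<in>S. (d a)\<^sup>2) * x)" if "S \<subseteq> K" for S d
  proof -
    have "(\<Sum>a\<in>K. (if a \<in> S then d a else 0) * z a) = (\<Sum>a\<in>S. d a * z a)" for z
      using that K(1) by (intro sum.mono_neutral_cong_right) auto
    moreover have "(\<Sum>a\<in>K. (if a \<in> S then d a else 0)\<^sup>2) = (\<Sum>a\<in>S. (d a)\<^sup>2)"
      using that K(1) by (intro sum.mono_neutral_cong_right) auto
    ultimately show ?thesis using distr_gauss_sum[OF K(1), of "\<lambda>a. if a \<in> S then d a else 0"] by simp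
  qed
  have JK: "J \<subseteq> K" and LK: "L \<subseteq> K" by (auto simp: K_def)
  have \<rho>': "\<rho> = distr (gauss K) borel ?R'"
    by (simp only: \<rho>_def distr_sum[OF JK] distr_sum[OF LK] same)
  have vim: "f -` {..u} \<inter> S = {z \<in> S. f z \<le> u}" for f :: "('i \<Rightarrow> real) \<Rightarrow> real" and u S
    by auto
  have R: "measure (gauss K) {z \<in> space (gauss K). ?R z \<le> u} = cdf \<rho> u" for u
    unfolding cdf_def \<rho>_def by (simp only: measure_distr[OF RK(1) borel_closed[OF closed_atMost]] vim)
  have R': "measure (gauss K) {z \<in> space (gauss K). ?R' z \<le> u} = cdf \<rho> u" for u
    unfolding cdf_def \<rho>' by (simp only: measure_distr[OF RK(2) borel_closed[OF closed_atMost]] vim)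
  have RR': "measure (gauss K) {z \<in> space (gauss K). ?R z \<le> u \<and> ?R' z \<le> u} = (cdf \<rho> u)\<^sup>2" for u
  proof -
    have "measure (gauss K) {z \<in> space (gauss K). ?R z \<le> u \<and> ?R' z \<le> u}
      = measure (gauss K) ((\<lambda>z. (?R z, ?R' z)) -` ({..u} \<times> {..u}) \<inter> space (gauss K))"
      by (intro arg_cong[where f="measure (gauss K)"]) blast
    also have "\<dots> = measure (gauss K) (?R -` {..u} \<inter> space (gauss K)) * measure (gauss K) (?R' -` {..u} \<inter> space (gauss K))"
      by (rule K.indep_varD[OF indep_gauss_sums]) (use disj fin(3) in \<open>auto simp: K_def\<close>)
    finally show ?thesis unfolding vim R R' power2_eq_square .
  qed
  have upd: "?R (z(i := y)) = ?R z" "?R' (z(i := y)) = ?R' z" for z y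
    using disj by (auto intro!: sum.cong)
  have h01: "0 \<le> h y" "h y \<le> 1" for y
    unfolding h_def by (rule \<rho>.cdf_nonneg \<rho>.cdf_bounded_prob)+
  have hs: "(\<lambda>y. (h y)\<^sup>2) \<in> borel_measurable borel"
    by (rule borel_measurable_power[OF h_meas])
  have int: "integrable std_normal_distribution h" "integrable std_normal_distribution (\<lambda>y. (h y)\<^sup>2)"
  proof -
    have meas: "h \<in> borel_measurable std_normal_distribution"
        "(\<lambda>y. (h y)\<^sup>2) \<in> borel_measurable std_normal_distribution"
      unfolding measurable_cong_sets[OF sets_std_normal refl] by (rule h_meas hs)+
    have "AE y in std_normal_distribution. norm (h y) \<le> 1"
      by (rule AE_I2) (simp add: h01)
    from std.integrable_const_bound[OF this meas(1)] show "integrable std_normal_distribution h" .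
    have "AE y in std_normal_distribution. norm ((h y)\<^sup>2) \<le> 1"
      by (rule AE_I2) (simp add: h01 power_le_one)
    from std.integrable_const_bound[OF this meas(2)]
    show "integrable std_normal_distribution (\<lambda>y. (h y)\<^sup>2)" .
  qed
  have RI: "?R \<in> borel_measurable (gauss I)" "?R' \<in> borel_measurable (gauss I)"
    by (intro borel_measurable_gauss_sum; auto simp: I)+
  have zi: "(\<lambda>z. \<tau> * z i) \<in> borel_measurable (gauss I)"
    by (intro borel_measurable_times borel_measurable_const borel_measurable_gauss) (simp add: I)
  note le = borel_measurable_le[OF borel_measurable_add borel_measurable_const]
  note f = le[OF zi RI(1), of t] and f' = le[OF zi RI(2), of t]
  have g: "{z \<in> space (gauss K). \<tau> * y + ?R z \<le> t} \<in> sets (gauss K)"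
    and g': "{z \<in> space (gauss K). \<tau> * y + ?R' z \<le> t} \<in> sets (gauss K)" for y
    by (rule le[OF borel_measurable_const RK(1)], rule le[OF borel_measurable_const RK(2)])
  have shift: "a + b \<le> t \<longleftrightarrow> b \<le> t - a" for a b :: real by linarith
  have Eh: "(\<integral>y. h y \<partial>std_normal_distribution) = 1 / 2"
  proof -
    let ?P = "\<lambda>y z. \<tau> * y + ?R z \<le> t"
    have eq: "measure (gauss K) {z \<in> space (gauss K). ?P y z} = h y" for y
      unfolding h_def R[symmetric] shift ..
    have upd': "?P y (z(i := y)) = ?P y z" for y z by (simp only: upd)
    have "(\<lambda>y. measure (gauss K) {z \<in> space (gauss K). ?P y z}) \<in> borel_measurable borel"
      unfolding eq by (rule h_meas)
    from measure_gauss_insert[OF K(1,2), where P="?P", folded K(3), OF f g upd' this]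
    show ?thesis unfolding half eq by (rule sym)
  qed
  have Eh2: "(\<integral>y. (h y)\<^sup>2 \<partial>std_normal_distribution) = 1 / 4"
  proof -
    let ?P = "\<lambda>y z. \<tau> * y + ?R z \<le> t \<and> \<tau> * y + ?R' z \<le> t"
    have eq: "measure (gauss K) {z \<in> space (gauss K). ?P y z} = (h y)\<^sup>2" for y
      unfolding h_def RR'[symmetric] shift ..
    have upd': "?P y (z(i := y)) = ?P y z" for y z by (simp only: upd)
    have "(\<lambda>y. measure (gauss K) {z \<in> space (gauss K). ?P y z}) \<in> borel_measurable borel"
      unfolding eq by (rule hs)
    from measure_gauss_insert[OF K(1,2), where P="?P", folded K(3),
        OF sets.sets_Collect_conj[OF f' f] sets.sets_Collect_conj[OF g' g] upd' this]
    show ?thesis unfolding quarter eq by (rule sym)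
  qed
  \<comment> \<open>With mean 1/2 and second moment 1/4, \<open>h\<close> has variance 0 and is
    constant almost surely.\<close>
  have "(\<integral>y. (h y - 1 / 2)\<^sup>2 \<partial>std_normal_distribution) = (\<integral>y. (h y)\<^sup>2 - h y + 1 / 4 \<partial>std_normal_distribution)"
    by (intro Bochner_Integration.integral_cong refl) (simp add: power2_eq_square algebra_simps)
  also have "\<dots> = 0" using int Eh Eh2 std.prob_space by simp
  finally have "(\<integral>y. (h y - 1 / 2)\<^sup>2 \<partial>std_normal_distribution) = 0" .
  moreover have "integrable std_normal_distribution (\<lambda>y. (h y - 1 / 2)\<^sup>2)"
  proof -
    have "(\<lambda>y. (h y - 1 / 2)\<^sup>2) = (\<lambda>y. (h y)\<^sup>2 - h y + 1 / 4)"
      by (auto simp: fun_eq_iff power2_eq_square algebra_simps)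
    then show ?thesis using int by simp
  qed
  ultimately have "AE y in std_normal_distribution. (h y - 1 / 2)\<^sup>2 = 0"
    by (subst (asm) integral_nonneg_eq_0_iff_AE) auto
  then have "AE y in std_normal_distribution. h y = 1 / 2" by (rule eventually_mono) simp
  then have ae: "AE y in lborel. h y = 1 / 2"
    by (subst (asm) AE_density) (auto simp: normal_density_pos elim!: eventually_mono)
  \<comment> \<open>A constant 1/2 is impossible: as \<open>\<tau> > 0\<close>, the argument of the
    distribution function tends to minus infinity for growing \<open>y\<close>, so \<open>h\<close>
    tends to 0 and the interval \<open>{b..b+1}\<close> would be a null set.\<close>
  have "filterlim (\<lambda>y. t + - \<tau> * y) at_bot at_top"
    using \<tau> by (intro filterlim_tendsto_add_at_bot_iff[THEN iffD2, OF tendsto_const]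
        filterlim_tendsto_neg_mult_at_bot[OF tendsto_const _ filterlim_ident]) simp
  then have "filterlim (\<lambda>y. t - \<tau> * y) at_bot at_top" by simp
  then have "(h \<longlongrightarrow> 0) at_top"
    unfolding h_def[abs_def] by (rule filterlim_compose[OF \<rho>.cdf_lim_at_bot])
  then have "eventually (\<lambda>y. h y < 1 / 2) at_top"
    by (rule order_tendstoD) simp
  then obtain b where b: "\<And>y. y \<ge> b \<Longrightarrow> h y < 1 / 2" by (auto simp: eventually_at_top_linorder)
  have "AE y in lborel. y \<notin> {b..b+1}" using ae by (rule eventually_mono) (use b in force)
  then have "{b..b+1} \<in> null_sets lborel"
    by (subst AE_iff_null_sets) simp_all
  then show False by (simp add: null_sets_def)
qed

text \<open>A uniform random subset of \<open>V\<close> is a family of independent fair coins: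
  exactly \<open>2 ^ (card V - card T)\<close> subsets contain \<open>T\<close>. It is needed for
  one edge and for two.\<close>

lemma (in prob_space) prob_all_of_uniform:
  assumes V: "finite V" and T: "T \<subseteq> V"
    and Q: "\<And>e. {x \<in> space M. Q e x} \<in> events"
    and unif: "\<And>g. g \<subseteq> V \<Longrightarrow> prob {x \<in> space M. \<forall>e\<in>V. Q e x \<longleftrightarrow> e \<in> g} = 1 / 2 ^ card V"
  shows "prob {x \<in> space M. \<forall>e\<in>T. Q e x} = 1 / 2 ^ card T"
proof -
  define W where "W g = {x \<in> space M. \<forall>e\<in>V. Q e x \<longleftrightarrow> e \<in> g}" for g
  let ?S = "{g. T \<subseteq> g \<and> g \<subseteq> V}"
  have fin: "finite ?S" by (rule finite_subset[of _ "Pow V"]) (use V in auto)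
  have W: "W g \<in> events" for g
    unfolding W_def
  proof (rule sets.sets_Collect_finite_All[OF _ V])
    fix e
    show "{x \<in> space M. Q e x \<longleftrightarrow> e \<in> g} \<in> events"
      using Q[of e] sets.sets_Collect_neg[OF Q[of e]] by (cases "e \<in> g") simp_all
  qed
  have "{x \<in> space M. \<forall>e\<in>T. Q e x} = (\<Union>g\<in>?S. W g)"
  proof
    show "{x \<in> space M. \<forall>e\<in>T. Q e x} \<subseteq> (\<Union>g\<in>?S. W g)"
    proof
      fix x assume x: "x \<in> {x \<in> space M. \<forall>e\<in>T. Q e x}"
      then have "{e \<in> V. Q e x} \<in> ?S" using T by auto
      moreover have "x \<in> W {e \<in> V. Q e x}" using x by (auto simp: W_def)
      ultimately show "x \<in> (\<Union>g\<in>?S. W g)" by blast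
    qed
    show "(\<Union>g\<in>?S. W g) \<subseteq> {x \<in> space M. \<forall>e\<in>T. Q e x}"
      using T by (auto simp: W_def)
  qed
  moreover have "disjoint_family_on W ?S"
    unfolding disjoint_family_on_def W_def by blast
  ultimately have "prob {x \<in> space M. \<forall>e\<in>T. Q e x} = (\<Sum>g\<in>?S. prob (W g))"
    using W fin by (simp add: finite_measure_finite_Union image_subset_iff)
  also have "\<dots> = (\<Sum>g\<in>?S. 1 / 2 ^ card V)"
    by (intro sum.cong refl) (simp add: W_def unif)
  also have "card ?S = 2 ^ (card V - card T)"
  proof -
    have "bij_betw (\<lambda>h. T \<union> h) (Pow (V - T)) ?S"
      by (rule bij_betw_byWitness[where f'="\<lambda>g. g - T"]) (use T in auto)
    then have "card ?S = card (Pow (V - T))" by (simp add: bij_betw_same_card)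
    then show ?thesis using V T by (simp add: card_Pow card_Diff_subset finite_subset)
  qed
  then have "(\<Sum>g\<in>?S. 1 / 2 ^ card V) = 2 ^ (card V - card T) / (2 ^ card V :: real)" by simp
  also have "\<dots> = 1 / 2 ^ card T"
    using card_mono[OF V T] by (simp add: power_diff)
  finally show ?thesis .
qed

section \<open>Limit law of the graph\<close>

context cube_coordinate begin

text \<open>For singletons this is the kurtosis bound multiplied by \<open>var\<^sup>2\<close>; zero
  variance is excluded because it would make \<open>kurtosis \<pi>\<close> equal to 0.\<close>

lemma feature_var_pos:
  assumes "kurtosis \<pi> > 1"
  shows "feature_var a > 0"
proof -
  have "var \<noteq> 0" using assms by (auto simp: kurtosis_def)
  then have "var\<^sup>2 > 0" by simp
  then show ?thesis using assms by (auto simp: kurtosis_def feature_var_def)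
qed

text \<open>\<open>z {i}\<close> and \<open>z {i, j}\<close> are the standard normals attached to
  vertices and pairs; the factor \<open>sqrt (feature_var a)\<close> restores the variances of the
  features.\<close>

definition limit_score :: "nat \<Rightarrow> real \<Rightarrow> nat set \<Rightarrow> (nat set \<Rightarrow> real) \<Rightarrow> real" where
  "limit_score n t e z = (\<Sum>a\<in>index_sets n. (edge_coeff e a * sqrt (feature_var a)) * z a) - t"

lemma borel_measurable_limit_score: "limit_score n t e \<in> borel_measurable (gauss (index_sets n))"
  unfolding limit_score_def
  by (intro borel_measurable_diff borel_measurable_gauss_sum borel_measurable_const) simp

lemma vertex_pairs_subset_index_sets: "vertex_pairs n \<subseteq> index_sets n"
  by (auto simp: vertex_pairs_def index_sets_def)

text \<open>The closed form is literally the limit in \<open>iexp_edge_score_tendsto\<close>, which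
  identifies \<open>limit_score\<close> as the joint limit of the edge scores.\<close>

lemma integral_iexp_limit_score:
  assumes "kurtosis \<pi> > 1"
  shows "(\<integral>z. iexp (\<Sum>e\<in>vertex_pairs n. \<theta> e * limit_score n t e z) \<partial>gauss (index_sets n)) =
    complex_of_real (exp (- (\<Sum>a\<in>index_sets n. (\<Sum>e\<in>vertex_pairs n. \<theta> e * edge_coeff e a)\<^sup>2 * feature_var a) / 2))
      * iexp (- t * (\<Sum>e\<in>vertex_pairs n. \<theta> e))"
proof -
  let ?c = "\<lambda>a. (\<Sum>e\<in>vertex_pairs n. \<theta> e * edge_coeff e a) * sqrt (feature_var a)"
  have eq: "(\<Sum>e\<in>vertex_pairs n. \<theta> e * limit_score n t e z) = (\<Sum>a\<in>index_sets n. ?c a * z a) + - t * (\<Sum>e\<in>vertex_pairs n. \<theta> e)" for z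
  proof -
    have "(\<Sum>e\<in>vertex_pairs n. \<theta> e * limit_score n t e z) =
      (\<Sum>e\<in>vertex_pairs n. \<Sum>a\<in>index_sets n. \<theta> e * edge_coeff e a * sqrt (feature_var a) * z a) - (\<Sum>e\<in>vertex_pairs n. t * \<theta> e)"
      unfolding limit_score_def sum_subtractf[symmetric] right_diff_distrib sum_distrib_left
      by (simp only: mult.assoc mult.commute[of t])
    also have "(\<Sum>e\<in>vertex_pairs n. \<Sum>a\<in>index_sets n. \<theta> e * edge_coeff e a * sqrt (feature_var a) * z a) =
      (\<Sum>a\<in>index_sets n. \<Sum>e\<in>vertex_pairs n. \<theta> e * edge_coeff e a * sqrt (feature_var a) * z a)"
      by (rule sum.swap)
    finally show ?thesis by (simp add: sum_distrib_right sum_distrib_left sum_negf)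
  qed
  have "(?c a)\<^sup>2 = (\<Sum>e\<in>vertex_pairs n. \<theta> e * edge_coeff e a)\<^sup>2 * feature_var a" for a
    using feature_var_pos[OF assms, of a] by (simp add: power_mult_distrib)
  then show ?thesis
    unfolding eq of_real_add distrib_left exp_add integral_mult_left_zero integral_iexp_gauss[OF finite_index_sets]
    by simp
qed

text \<open>The coordinate of the edge itself has the nonzero coefficient
  \<open>- 2 * sqrt (feature_var e)\<close>, so the score is a nondegenerate Gaussian.\<close>

lemma limit_score_no_atom:
  assumes "kurtosis \<pi> > 1" "e \<in> vertex_pairs n"
  shows "measure (gauss (index_sets n)) {z \<in> space (gauss (index_sets n)). limit_score n t e z = 0} = 0"
proof -
  have e: "e \<in> index_sets n" using assms vertex_pairs_subset_index_sets by blast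
  have "0 < (edge_coeff e e * sqrt (feature_var e))\<^sup>2"
    using feature_var_pos[OF assms(1), of e] by (simp add: edge_coeff_def)
  also have "\<dots> \<le> (\<Sum>a\<in>index_sets n. (edge_coeff e a * sqrt (feature_var a))\<^sup>2)"
    using e by (intro member_le_sum finite_index_sets) auto
  finally have "measure (gauss (index_sets n))
    {z \<in> space (gauss (index_sets n)). (\<Sum>a\<in>index_sets n. (edge_coeff e a * sqrt (feature_var a)) * z a) = t} = 0"
    by (rule gauss_sum_no_atom[OF finite_index_sets])
  then show ?thesis by (simp only: limit_score_def right_minus_eq)
qed

definition limit_prob :: "nat \<Rightarrow> real \<Rightarrow> nat set set \<Rightarrow> real" where
  "limit_prob n t g = measure (gauss (index_sets n))
     {z \<in> space (gauss (index_sets n)). \<forall>e\<in>vertex_pairs n. limit_score n t e z \<in> (if e \<in> g then {..0} else {0<..})}"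

lemma measure_cube_rgg_tendsto:
  assumes kurt: "kurtosis \<pi> > 1" and n: "n \<ge> 1" and r: "\<And>d. r d \<ge> 0"
    and t: "(\<lambda>d. (r d)\<^sup>2 / sqrt (real d) - mean_sq_dist \<pi> * sqrt (real d)) \<longlonglongrightarrow> t"
    and g: "g \<subseteq> vertex_pairs n"
  shows "(\<lambda>d. measure (cube_rgg d \<pi> n (r d)) {g}) \<longlonglongrightarrow> limit_prob n t g"
proof -
  have "(\<lambda>d. measure grid {\<omega> \<in> space grid. \<forall>e\<in>vertex_pairs n. edge_score n d (r d) e \<omega> \<in> (if e \<in> g then {..0} else {0<..})})
    \<longlonglongrightarrow> limit_prob n t g"
    unfolding limit_prob_def
  proof (rule prob_tendsto_of_iexp_tendsto[OF prob_space_grid prob_space_gauss finite_vertex_pairs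
        borel_measurable_edge_score borel_measurable_limit_score])
    fix e assume e: "e \<in> vertex_pairs n"
    \<comment> \<open>Both half-lines have boundary \<open>{0}\<close>, so an atom of the limit at 0
      would be the only obstruction.\<close>
    have fr: "frontier (if e \<in> g then {..0} else {0<..}) = {0::real}"
      by (auto simp: frontier_def interior_open)
    show "measure (gauss (index_sets n)) {z \<in> space (gauss (index_sets n)).
        limit_score n t e z \<in> frontier (if e \<in> g then {..0} else {0<..})} = 0"
      unfolding fr singleton_iff by (rule limit_score_no_atom[OF kurt e])
  next
    fix \<theta>
    show "(\<lambda>d. \<integral>x. iexp (\<Sum>e\<in>vertex_pairs n. \<theta> e * edge_score n d (r d) e x) \<partial>grid)
      \<longlonglongrightarrow> (\<integral>x. iexp (\<Sum>e\<in>vertex_pairs n. \<theta> e * limit_score n t e x) \<partial>gauss (index_sets n))"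
      unfolding integral_iexp_limit_score[OF kurt] by (rule iexp_edge_score_tendsto[OF t])
  qed simp
  moreover have "\<forall>\<^sub>F d in sequentially.
      measure grid {\<omega> \<in> space grid. \<forall>e\<in>vertex_pairs n. edge_score n d (r d) e \<omega> \<in> (if e \<in> g then {..0} else {0<..})}
      = measure (cube_rgg d \<pi> n (r d)) {g}"
    using eventually_ge_at_top[of 1] by eventually_elim (simp only: measure_cube_rgg[OF n _ r g])
  ultimately show ?thesis by (rule Lim_transform_eventually)
qed

text \<open>Under a uniform law the edges \<open>{1, 2}\<close> and \<open>{1, 3}\<close> would be
  independent fair coins. But both scores contain \<open>z {1}\<close> with the same positive
  coefficient and otherwise use disjoint coordinates, which
  \<open>correlated_gauss_not_fair_coins\<close> rules out.\<close>

lemma limit_prob_not_uniform: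
  assumes kurt: "kurtosis \<pi> > 1" and n: "n \<ge> 3"
  shows "\<exists>g\<in>Pow (vertex_pairs n). limit_prob n t g \<noteq> 1 / 2 ^ (n choose 2)"
proof (rule ccontr)
  assume "\<not> ?thesis"
  then have unif: "limit_prob n t g = 1 / 2 ^ card (vertex_pairs n)" if "g \<subseteq> vertex_pairs n" for g
    using that by (auto simp: card_vertex_pairs)
  let ?I = "index_sets n"
  interpret G: prob_space "gauss ?I" by (rule prob_space_gauss)
  have fair: "measure (gauss ?I) {z \<in> space (gauss ?I). \<forall>e\<in>T. limit_score n t e z \<le> 0} = 1 / 2 ^ card T"
    if "T \<subseteq> vertex_pairs n" for T
  proof (rule G.prob_all_of_uniform[OF finite_vertex_pairs that])
    show "{z \<in> space (gauss ?I). limit_score n t e z \<le> 0} \<in> G.events" for e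
      by (rule borel_measurable_le[OF borel_measurable_limit_score borel_measurable_const])
    fix g assume g: "g \<subseteq> vertex_pairs n"
    have "(limit_score n t e z \<le> 0 \<longleftrightarrow> e \<in> g) \<longleftrightarrow> limit_score n t e z \<in> (if e \<in> g then {..0} else {0<..})" for e z
      by (simp add: not_le)
    then show "measure (gauss ?I) {z \<in> space (gauss ?I). \<forall>e\<in>vertex_pairs n. limit_score n t e z \<le> 0 \<longleftrightarrow> e \<in> g}
        = 1 / 2 ^ card (vertex_pairs n)"
      using unif[OF g] by (simp only: limit_prob_def)
  qed
  define s where "s a = sqrt (feature_var a)" for a
  define J where "J = {{2}, {1, 2::nat}}"
  \<comment> \<open>\<open>L\<close> takes all remaining coordinates, so that \<open>{1}\<close>,
    \<open>J\<close> and \<open>L\<close> exhaust the index set; its members other than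
    \<open>{3}\<close> and \<open>{1, 3}\<close> enter the second score with coefficient 0.\<close>
  define L where "L = ?I - insert {1} J"
  have mem: "{1} \<in> ?I" "{2} \<in> ?I" "{3} \<in> ?I" "{1, 2} \<in> ?I" "{1, 3} \<in> ?I"
    using n by (auto simp: index_sets_def)
  have score2: "limit_score n t {1, 2} z \<le> 0 \<longleftrightarrow> s {1} * z {1} + (\<Sum>a\<in>J. (edge_coeff {1, 2} a * s a) * z a) \<le> t" for z
  proof -
    have "(\<Sum>a\<in>?I. edge_coeff {1, 2} a * (s a * z a)) = s {1} * z {1} + s {2} * z {2} - 2 * (s {1, 2} * z {1, 2})"
      by (rule sum_edge_coeff) (use n in auto)
    moreover have "(\<Sum>a\<in>J. (edge_coeff {1, 2} a * s a) * z a) = s {2} * z {2} - 2 * (s {1, 2} * z {1, 2})"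
      by (simp add: J_def edge_coeff_def)
    ultimately show ?thesis by (simp add: limit_score_def s_def mult.assoc add_diff_eq)
  qed
  have L3: "(\<Sum>a\<in>L. f a) = f {3} + f {1, 3}" if "\<And>a. a \<in> L \<Longrightarrow> edge_coeff {1, 3} a = 0 \<Longrightarrow> f a = 0" for f :: "nat set \<Rightarrow> real"
  proof -
    have "(\<Sum>a\<in>L. f a) = (\<Sum>a\<in>{{3}, {1, 3}}. f a)"
    proof (rule sum.mono_neutral_right)
      show "finite L" by (simp add: L_def finite_index_sets)
      show "{{3}, {1, 3}} \<subseteq> L" using mem by (auto simp: L_def J_def doubleton_eq_iff)
      show "\<forall>a\<in>L - {{3}, {1, 3}}. f a = 0"
        by (intro ballI that) (auto simp: edge_coeff_def L_def card_1_singleton_iff)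
    qed
    then show ?thesis by (simp add: doubleton_eq_iff)
  qed
  have score3: "limit_score n t {1, 3} z \<le> 0 \<longleftrightarrow> s {1} * z {1} + (\<Sum>a\<in>L. (edge_coeff {1, 3} a * s a) * z a) \<le> t" for z
  proof -
    have "(\<Sum>a\<in>?I. edge_coeff {1, 3} a * (s a * z a)) = s {1} * z {1} + s {3} * z {3} - 2 * (s {1, 3} * z {1, 3})"
      by (rule sum_edge_coeff) (use n in auto)
    moreover have "(\<Sum>a\<in>L. (edge_coeff {1, 3} a * s a) * z a) = s {3} * z {3} - 2 * (s {1, 3} * z {1, 3})"
      by (subst L3) (simp_all add: edge_coeff_def)
    ultimately show ?thesis by (simp add: limit_score_def s_def mult.assoc add_diff_eq)
  qed
  show False
  proof (rule correlated_gauss_not_fair_coins[where J = J and L = L and i = "{1}" and I = ?I and \<tau> = "s {1}" and t = t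
        and c = "\<lambda>a. edge_coeff {1, 2} a * s a" and c' = "\<lambda>a. edge_coeff {1, 3} a * s a"])
    show "finite J" "J \<noteq> {}" "finite L" by (simp_all add: J_def L_def finite_index_sets)
    show "J \<inter> L = {}" "{1} \<notin> J \<union> L" by (auto simp: J_def L_def)
    show "0 < s {1}" using feature_var_pos[OF kurt] by (simp add: s_def)
    show "?I = insert {1} (J \<union> L)" using mem by (auto simp: J_def L_def)
    have "(\<Sum>a\<in>J. (edge_coeff {1, 2} a * s a)\<^sup>2) = (s {2})\<^sup>2 + 4 * (s {1, 2})\<^sup>2"
      by (simp add: J_def edge_coeff_def power_mult_distrib)
    \<comment> \<open>\<open>feature_var\<close> depends only on the cardinality, so the unshared
      parts of both scores have equal variance.\<close>
    also have "\<dots> = (s {3})\<^sup>2 + 4 * (s {1, 3})\<^sup>2" by (simp add: s_def feature_var_def)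
    also have "\<dots> = (\<Sum>a\<in>L. (edge_coeff {1, 3} a * s a)\<^sup>2)"
      by (subst L3) (simp_all add: edge_coeff_def power_mult_distrib)
    finally show "(\<Sum>a\<in>J. (edge_coeff {1, 2} a * s a)\<^sup>2) = (\<Sum>a\<in>L. (edge_coeff {1, 3} a * s a)\<^sup>2)" .
    have V: "{1, 2} \<in> vertex_pairs n" "{1, 3} \<in> vertex_pairs n" using n by (auto simp: vertex_pairs_def)
    show "measure (gauss ?I) {z \<in> space (gauss ?I). s {1} * z {1} + (\<Sum>a\<in>J. (edge_coeff {1, 2} a * s a) * z a) \<le> t} = 1 / 2"
      using fair[of "{{1, 2}}"] V unfolding score2[symmetric] by simp
    have "card {{1, 2}, {1, 3::nat}} = 2" by (simp add: doubleton_eq_iff)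
    then show "measure (gauss ?I) {z \<in> space (gauss ?I). s {1} * z {1} + (\<Sum>a\<in>J. (edge_coeff {1, 2} a * s a) * z a) \<le> t
        \<and> s {1} * z {1} + (\<Sum>a\<in>L. (edge_coeff {1, 3} a * s a) * z a) \<le> t} = 1 / 4"
      using fair[of "{{1, 2}, {1, 3}}"] V unfolding score2[symmetric] score3[symmetric] by simp
  qed
qed

end

theorem theorem4:
  fixes \<pi> :: "real measure" and n :: nat and r\<^sub>0 :: "nat \<Rightarrow> real" and t :: real
  assumes "n \<ge> 3"
    and "prob_space \<pi>" and "sets \<pi> = sets (restrict_space borel {0..1})"
    and "\<And>d. r\<^sub>0 d \<ge> 0"
    and "(\<lambda>d. (r\<^sub>0 d)\<^sup>2 / sqrt (real d) - mean_sq_dist \<pi> * sqrt (real d)) \<longlonglongrightarrow> t"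
    and "kurtosis \<pi> > 1"
  shows "(\<exists>H\<^sub>t. (\<lambda>d. ensemble_entropy (cube_rgg d \<pi> n (r\<^sub>0 d))) \<longlonglongrightarrow> H\<^sub>t
             \<and> H\<^sub>t < ensemble_entropy (erdos_renyi n (1/2)))
         \<and> ensemble_entropy (erdos_renyi n (1/2)) = real (n choose 2)"
proof -
  interpret cube_coordinate \<pi>
    using assms(2,3) by (simp add: cube_coordinate_def cube_coordinate_axioms_def)
  let ?S = "Pow (vertex_pairs n)"
  let ?p = "\<lambda>d g. measure (cube_rgg d \<pi> n (r\<^sub>0 d)) {g}"
  have space: "space (cube_rgg d \<pi> n (r\<^sub>0 d)) = ?S" "sets (cube_rgg d \<pi> n (r\<^sub>0 d)) = Pow ?S" for d
    by (simp_all add: cube_rgg_def hard_rgg_def)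
  have lim: "(\<lambda>d. ?p d g) \<longlonglongrightarrow> limit_prob n t g" if "g \<in> ?S" for g
    using assms that by (intro measure_cube_rgg_tendsto) auto
  \<comment> \<open>The set of graphs is finite and independent of \<open>d\<close>, so convergence
    of each graph probability suffices for the entropy.\<close>
  have "(\<lambda>d. ensemble_entropy (cube_rgg d \<pi> n (r\<^sub>0 d)))
      \<longlonglongrightarrow> - (\<Sum>g\<in>?S. limit_prob n t g * log 2 (limit_prob n t g))"
    unfolding ensemble_entropy_def space
    by (intro tendsto_minus tendsto_sum tendsto_mult_log lim) simp_all
  moreover have "- (\<Sum>g\<in>?S. limit_prob n t g * log 2 (limit_prob n t g)) < log 2 (card ?S)"
  proof -
    obtain g where g: "g \<in> ?S" "limit_prob n t g \<noteq> 1 / 2 ^ (n choose 2)"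
      using limit_prob_not_uniform[OF assms(6,1)] by blast
    have card: "card ?S = 2 ^ (n choose 2)"
      by (simp add: card_Pow finite_vertex_pairs card_vertex_pairs)
    have "(\<Sum>g\<in>?S. ?p d g) = 1" for d
    proof -
      interpret R: prob_space "cube_rgg d \<pi> n (r\<^sub>0 d)"
        by (rule prob_space_cube_rgg[OF assms(2,3)])
      have "measure (cube_rgg d \<pi> n (r\<^sub>0 d)) ?S = (\<Sum>g\<in>?S. ?p d g)"
        by (rule R.finite_measure_eq_sum_singleton) (auto simp: finite_vertex_pairs space)
      then show ?thesis using R.prob_space by (simp add: space)
    qed
    moreover have "(\<lambda>d. \<Sum>g\<in>?S. ?p d g) \<longlonglongrightarrow> (\<Sum>g\<in>?S. limit_prob n t g)"
      by (intro tendsto_sum lim)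
    ultimately have "(\<Sum>g\<in>?S. limit_prob n t g) = 1"
      by (simp add: LIMSEQ_const_iff)
    then show ?thesis
      using g by (intro entropy_less_log_card) (auto simp: finite_vertex_pairs limit_prob_def card)
  qed
  moreover have "log 2 (card ?S) = real (n choose 2)"
    by (simp add: card_Pow finite_vertex_pairs card_vertex_pairs log_nat_power)
  ultimately show ?thesis
    unfolding entropy_erdos_renyi_half by auto
qed

end
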